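(* Let $A\subset C$ and $B\subset D$ be unital inclusions of unital $C^*$-algebras which are strongly Morita equivalent with respect to a $C-D$-equivalence bimodule $Y$ and its closed subspace $X$. Let $E^A:C\to A$ and $E^B:D\to B$ be conditional expectations of Watatani index-finite type with $\mathrm{Ind}_W(E^A)\in A$ and $\mathrm{Ind}_W(E^B)\in B$, and let $E^X$ be a conditional expectation from $Y$ onto $X$ with respect to $E^A$ and $E^B$. Let $C_1,D_1$ be the $C^*$-basic constructions for $E^A,E^B$ with Jones projections $e_A,e_B$ and dual conditional expectations $E^C,E^D$; let $Y_1$ be the upward basic construction for $E^X$ and $E^Y:Y_1\to Y$ the dual conditional expectation of $E^X$. Then $X$ can be regarded as the downward basic construction for $E^Y$ (taken with respect to the full projections $e_A\in C_1$ and $e_B\in D_1$), and $E^X$ can be regarded as the pre-dual conditional expectation of $E^Y$. That is, with $\phi:Y\to Y_1$ the inclusion map, $$X=\{y\in Y\mid e_A\cdot\phi(y)=\phi(y)\cdot e_B\}\quad\text{and}\quad E^X(y)=\mathrm{Ind}_W(E^C)\cdot E^Y(e_A\cdot\phi(y)\cdot e_B)\ \text{ for all }y\in Y.$$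
   Context: Equivalence bimodules are imprimitivity bimodules; actions are written $c\cdot y$, $y\cdot d$; ${}_C\langle\ ,\ \rangle$ (linear in the first variable) and $\langle\ ,\ \rangle_D$ (linear in the second variable) are the inner products. For sets, $\langle U,V\rangle$ means the linear span of the inner products. Strong Morita equivalence of inclusions: unital inclusions $A\subset C$, $B\subset D$ are strongly Morita equivalent with respect to a $C-D$-equivalence bimodule $Y$ and its closed subspace $X$ if (1) $a\cdot x\in X$ and ${}_C\langle x,y\rangle\in A$ for $a\in A$, $x,y\in X$, and $\overline{{}_C\langle X,X\rangle}=A$, $\overline{{}_C\langle Y,X\rangle}=C$; (2) $x\cdot b\in X$ and $\langle x,y\rangle_D\in B$ for $b\in B$, $x,y\in X$, and $\overline{\langle X,X\rangle_D}=B$, $\overline{\langle Y,X\rangle_D}=D$. Then $X$ is an $A-B$-equivalence bimodule. A linear map $E^X$ from $Y$ onto $X$ is a conditional expectation with respect to $E^A$ and $E^B$ if, for all $a\in A,b\in B,c\in C,d\in D,x\in X,y\in Y$: $E^X(c\cdot x)=E^A(c)\cdot x$; $E^X(a\cdot y)=a\cdot E^X(y)$; $E^A({}_C\langle y,x\rangle)={}_C\langle E^X(y),x\rangle$; $E^X(x\cdot d)=x\cdot E^B(d)$; $E^X(y\cdot b)=E^X(y)\cdot b$; $E^B(\langle y,x\rangle_D)=\langle E^X(y),x\rangle_D$. $E^A$ is of Watatani index-finite type if it has a quasi-basis: a finite family $\{(u_i,u_i^* )\}$ with $u_i\in C$ and $\sum_i u_iE^A(u_i^*c)=c=\sum_i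 E^A(cu_i)u_i^*$ for all $c\in C$; then $\mathrm{Ind}_W(E^A)=\sum_i u_iu_i^*\in C\cap C'$, positive and invertible. The $C^*$-basic construction $C_1$ for $E^A$, with Jones projection $e_A$, is the linear span of $\{c_1e_Ac_2: c_1,c_2\in C\}$, where $e_Ace_A=E^A(c)e_A$; the dual conditional expectation is $E^C(c_1e_Ac_2)=\mathrm{Ind}_W(E^A)^{-1}c_1c_2$. Since $\mathrm{Ind}_W(E^A)\in A$, $\mathrm{Ind}_W(E^C)=\mathrm{Ind}_W(E^A)$. $C$ is a $C_1-A$-equivalence bimodule via ${}_{C_1}\langle x,y\rangle=xe_Ay^*$, $\langle x,y\rangle_A=E^A(x^*y)$, $(xe_Ay)\cdot z=xE^A(yz)$, $x\cdot a=xa$. Likewise for $D_1,e_B,E^D$. Upward basic construction for $E^X$: $Y_1=C\otimes_A X\otimes_B\widetilde D$, a $C_1-D_1$-equivalence bimodule, where $\widetilde D=\{\widetilde d:d\in D\}$ is the $B-D_1$-equivalence bimodule dual to the $D_1-B$-equivalence bimodule $D$. $Y$ is regarded as a closed subspace of $Y_1$ via $\phi(y)=\sum_{i,j}u_i\otimes E^X(u_i^*\cdot y\cdot v_j)\otimes\widetilde{v_j}$ ($\{(u_i,u_i^* )\}$, $\{(v_j,v_j^* )\}$ quasi-bases for $E^A$, $E^B$). The dual conditional expectation is $E^Y(c\otimes x\otimes\widetilde d)=\mathrm{Ind}_W(E^A)^{-1}c\cdot x\cdot d^*\in Y$. Downward basic construction: for unital inclusions $A\subset C$, $B\subset D$ of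 unital $C^*$-algebras which are strongly Morita equivalent with respect to a $C-D$-equivalence bimodule $Y$ and its closed subspace $X$, conditional expectations $E^A:C\to A$ and $E^B:D\to B$ of Watatani index-finite type with $\mathrm{Ind}_W(E^A)\in A$ and $\mathrm{Ind}_W(E^B)\in B$, a conditional expectation $E^X:Y\to X$ with respect to $E^A$ and $E^B$, and full projections $p\in C$, $q\in D$ with $E^A(p)=\mathrm{Ind}_W(E^A)^{-1}$, $E^B(q)=\mathrm{Ind}_W(E^B)^{-1}$, the downward basic construction of $X$ for $E^X$ is $Z=\{x\in X\mid p\cdot x=x\cdot q\}$ and the pre-dual conditional expectation of $E^X$ is $E^Z:X\to Z$, $E^Z(x)=\mathrm{Ind}_W(E^A)\cdot E^X(p\cdot x\cdot q)$. Here it is applied to $E^Y:Y_1\to Y$ with $p=e_A$, $q=e_B$. *)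

theory Defs
  imports "HOL-Analysis.Analysis" "HOL-Algebra.Free_Abelian_Groups" "HOL-Library.Function_Algebras"
begin

section \<open>Unital C*-algebras\<close>

class complex_vector = real_vector +
  fixes scaleC :: "complex \<Rightarrow> 'a \<Rightarrow> 'a" (infixr "*\<^sub>C" 75)
  assumes scaleC_add_right: "a *\<^sub>C (x + y) = a *\<^sub>C x + a *\<^sub>C y"
    and scaleC_add_left: "(a + b) *\<^sub>C x = a *\<^sub>C x + b *\<^sub>C x"
    and scaleC_scaleC: "a *\<^sub>C b *\<^sub>C x = (a * b) *\<^sub>C x"
    and scaleC_one: "1 *\<^sub>C x = x"
    and scaleR_scaleC: "scaleR r x = complex_of_real r *\<^sub>C x"

global_interpretation complex_vector:
  vector_space "scaleC :: complex \<Rightarrow> 'a \<Rightarrow> 'a::complex_vector"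
  by unfold_locales (simp_all add: scaleC_add_right scaleC_add_left scaleC_scaleC scaleC_one)

abbreviation clinear :: "('a::complex_vector \<Rightarrow> 'b::complex_vector) \<Rightarrow> bool"
  where "clinear \<equiv> Vector_Spaces.linear scaleC scaleC"

class complex_banach = complex_vector + banach +
  assumes norm_scaleC: "norm (a *\<^sub>C x) = cmod a * norm x"

text \<open>The zero algebra is admitted: \<open>monoid_mult\<close> supplies the unit without \<open>0 \<noteq> 1\<close>.\<close>

class cstar_algebra = complex_banach + real_normed_algebra + monoid_mult +
  fixes star :: "'a \<Rightarrow> 'a"
  assumes mult_scaleC_left: "(a *\<^sub>C x) * y = a *\<^sub>C (x * y)"
    and mult_scaleC_right: "x * (a *\<^sub>C y) = a *\<^sub>C (x * y)"
    and star_add: "star (x + y) = star x + star y"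
    and star_scaleC: "star (a *\<^sub>C x) = cnj a *\<^sub>C star x"
    and star_mult: "star (x * y) = star y * star x"
    and star_star: "star (star x) = x"
    and cstar_identity: "norm (star x * x) = (norm x)\<^sup>2"

definition positive :: "'a::cstar_algebra \<Rightarrow> bool"
  where "positive a \<longleftrightarrow> (\<exists>b. a = star b * b)"

definition mult_inverse :: "'a::cstar_algebra \<Rightarrow> 'a"
  where "mult_inverse a = (THE b. a * b = 1 \<and> b * a = 1)"

definition unital_inclusion :: "'a::cstar_algebra set \<Rightarrow> bool"
  where "unital_inclusion A \<longleftrightarrow>
    complex_vector.subspace A \<and> closed A \<and> 1 \<in> A \<and>
    (\<forall>a\<in>A. star a \<in> A) \<and> (\<forall>a\<in>A. \<forall>b\<in>A. a * b \<in> A)"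

section \<open>Equivalence bimodules\<close>

text \<open>The norm of the type \<open>'y\<close> is the Hilbert module norm; completeness is in the class.\<close>

locale left_hilbert_module =
  fixes lact :: "'c::cstar_algebra \<Rightarrow> 'y::complex_banach \<Rightarrow> 'y"
    and lip :: "'y \<Rightarrow> 'y \<Rightarrow> 'c"
  assumes lact_linear: "clinear (lact c)"
    and lact_linear_left: "clinear (\<lambda>c. lact c y)"
    and lact_mult: "lact (c * c') y = lact c (lact c' y)"
    and lact_one: "lact 1 y = y"
    and lip_linear: "clinear (\<lambda>y. lip y z)"
    and lip_lact: "lip (lact c y) z = c * lip y z"
    and lip_star: "star (lip y z) = lip z y"
    and lip_positive: "positive (lip y y)"
    and norm_lip: "norm (lip y y) = (norm y)\<^sup>2"

locale right_hilbert_module =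
  fixes ract :: "'y::complex_banach \<Rightarrow> 'd::cstar_algebra \<Rightarrow> 'y"
    and rip :: "'y \<Rightarrow> 'y \<Rightarrow> 'd"
  assumes ract_linear: "clinear (\<lambda>y. ract y d)"
    and ract_linear_right: "clinear (ract y)"
    and ract_mult: "ract y (d * d') = ract (ract y d) d'"
    and ract_one: "ract y 1 = y"
    and rip_linear: "clinear (rip y)"
    and rip_ract: "rip y (ract z d) = rip y z * d"
    and rip_star: "star (rip y z) = rip z y"
    and rip_positive: "positive (rip y y)"
    and norm_rip: "norm (rip y y) = (norm y)\<^sup>2"

locale equivalence_bimodule =
  left_hilbert_module lact lip + right_hilbert_module ract rip
  for lact :: "'c::cstar_algebra \<Rightarrow> 'y::complex_banach \<Rightarrow> 'y"
    and ract :: "'y \<Rightarrow> 'd::cstar_algebra \<Rightarrow> 'y"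
    and lip :: "'y \<Rightarrow> 'y \<Rightarrow> 'c"
    and rip :: "'y \<Rightarrow> 'y \<Rightarrow> 'd" +
  assumes lact_ract: "ract (lact c y) d = lact c (ract y d)"
    and lip_ract: "lip (ract y d) z = lip y (ract z (star d))"
    and rip_lact: "rip (lact c y) z = rip y (lact (star c) z)"
    and lip_rip: "lact (lip x y) z = ract x (rip y z)"
    and lip_full: "closure (complex_vector.span {lip y z | y z. True}) = UNIV"
    and rip_full: "closure (complex_vector.span {rip y z | y z. True}) = UNIV"

locale strongly_morita_equivalent_inclusions =
  equivalence_bimodule lact ract lip rip
  for A :: "'c::cstar_algebra set" and B :: "'d::cstar_algebra set"
    and lact :: "'c \<Rightarrow> 'y::complex_banach \<Rightarrow> 'y" and ract :: "'y \<Rightarrow> 'd \<Rightarrow> 'y"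
    and lip :: "'y \<Rightarrow> 'y \<Rightarrow> 'c" and rip :: "'y \<Rightarrow> 'y \<Rightarrow> 'd"
    and X :: "'y set" +
  assumes inclusion_left: "unital_inclusion A"
    and inclusion_right: "unital_inclusion B"
    and X_subspace: "complex_vector.subspace X"
    and X_closed: "closed X"
    and lact_X: "a \<in> A \<Longrightarrow> x \<in> X \<Longrightarrow> lact a x \<in> X"
    and lip_X: "x \<in> X \<Longrightarrow> y \<in> X \<Longrightarrow> lip x y \<in> A"
    and lip_X_full: "closure (complex_vector.span {lip x y | x y. x \<in> X \<and> y \<in> X}) = A"
    and lip_YX_full: "closure (complex_vector.span {lip y x | y x. x \<in> X}) = UNIV"
    and ract_X: "b \<in> B \<Longrightarrow> x \<in> X \<Longrightarrow> ract x b \<in> X"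
    and rip_X: "x \<in> X \<Longrightarrow> y \<in> X \<Longrightarrow> rip x y \<in> B"
    and rip_X_full: "closure (complex_vector.span {rip x y | x y. x \<in> X \<and> y \<in> X}) = B"
    and rip_YX_full: "closure (complex_vector.span {rip y x | y x. x \<in> X}) = UNIV"

section \<open>Conditional expectations\<close>

definition conditional_expectation :: "'c::cstar_algebra set \<Rightarrow> ('c \<Rightarrow> 'c) \<Rightarrow> bool"
  where "conditional_expectation A E \<longleftrightarrow>
    clinear E \<and> range E \<subseteq> A \<and> (\<forall>a\<in>A. E a = a) \<and>
    (\<forall>c. positive c \<longrightarrow> positive (E c)) \<and>
    (\<forall>a\<in>A. \<forall>c. E (a * c) = a * E c \<and> E (c * a) = E c * a)"

definition bimodule_conditional_expectation ::
  "'c::cstar_algebra set \<Rightarrow> 'd::cstar_algebra set \<Rightarrow>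
   ('c \<Rightarrow> 'y::complex_banach \<Rightarrow> 'y) \<Rightarrow> ('y \<Rightarrow> 'd \<Rightarrow> 'y) \<Rightarrow>
   ('y \<Rightarrow> 'y \<Rightarrow> 'c) \<Rightarrow> ('y \<Rightarrow> 'y \<Rightarrow> 'd) \<Rightarrow> 'y set \<Rightarrow>
   ('c \<Rightarrow> 'c) \<Rightarrow> ('d \<Rightarrow> 'd) \<Rightarrow> ('y \<Rightarrow> 'y) \<Rightarrow> bool"
  where "bimodule_conditional_expectation A B lact ract lip rip X E\<^sub>A E\<^sub>B E\<^sub>X \<longleftrightarrow>
    clinear E\<^sub>X \<and> range E\<^sub>X = X \<and>
    (\<forall>c. \<forall>x\<in>X. E\<^sub>X (lact c x) = lact (E\<^sub>A c) x) \<and>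
    (\<forall>a\<in>A. \<forall>y. E\<^sub>X (lact a y) = lact a (E\<^sub>X y)) \<and>
    (\<forall>y. \<forall>x\<in>X. E\<^sub>A (lip y x) = lip (E\<^sub>X y) x) \<and>
    (\<forall>x\<in>X. \<forall>d. E\<^sub>X (ract x d) = ract x (E\<^sub>B d)) \<and>
    (\<forall>y. \<forall>b\<in>B. E\<^sub>X (ract y b) = ract (E\<^sub>X y) b) \<and>
    (\<forall>y. \<forall>x\<in>X. E\<^sub>B (rip y x) = rip (E\<^sub>X y) x)"

section \<open>Quasi-bases and the Watatani index\<close>

text \<open>
  The algebra is given by a carrier \<open>R\<close>, a product and an involution, and the expectation as
  a map of \<open>R\<close> into itself, because the index is taken both for \<open>C\<close> and for the
  algebra of operators \<open>C\<^sub>1\<close>. A list \<open>us\<close> stands for the family of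
  pairs \<open>(u, u*)\<close>.
\<close>

definition quasi_basis ::
  "'r::comm_monoid_add set \<Rightarrow> ('r \<Rightarrow> 'r \<Rightarrow> 'r) \<Rightarrow> ('r \<Rightarrow> 'r) \<Rightarrow> ('r \<Rightarrow> 'r) \<Rightarrow> 'r list \<Rightarrow> bool"
  where "quasi_basis R m st E us \<longleftrightarrow>
    set us \<subseteq> R \<and>
    (\<forall>c\<in>R. (\<Sum>u\<leftarrow>us. m u (E (m (st u) c))) = c \<and> (\<Sum>u\<leftarrow>us. m (E (m c u)) (st u)) = c)"

definition watatani_index ::
  "'r::comm_monoid_add set \<Rightarrow> ('r \<Rightarrow> 'r \<Rightarrow> 'r) \<Rightarrow> ('r \<Rightarrow> 'r) \<Rightarrow> ('r \<Rightarrow> 'r) \<Rightarrow> 'r"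
  where "watatani_index R m st E =
    (THE k. \<exists>us. quasi_basis R m st E us \<and> k = (\<Sum>u\<leftarrow>us. m u (st u)))"

abbreviation cstar_quasi_basis :: "('c::cstar_algebra \<Rightarrow> 'c) \<Rightarrow> 'c list \<Rightarrow> bool"
  where "cstar_quasi_basis \<equiv> quasi_basis UNIV (*) star"

abbreviation cstar_index :: "('c::cstar_algebra \<Rightarrow> 'c) \<Rightarrow> 'c"
  where "cstar_index \<equiv> watatani_index UNIV (*) star"

section \<open>The C*-basic construction\<close>

text \<open>
  \<open>C\<^sub>1\<close> is realised as an algebra of operators on \<open>C\<close>, the latter being a right
  Hilbert \<open>A\<close>-module with inner product \<open>E (x* y)\<close>: the elements of \<open>C\<close> act by left
  multiplication, the Jones projection is \<open>E\<close> itself, the product is composition and the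
  involution is the module adjoint. The addition of operators is pointwise.
\<close>

definition left_mult :: "'c::cstar_algebra \<Rightarrow> 'c \<Rightarrow> 'c"
  where "left_mult c = (\<lambda>z. c * z)"

definition jones_projection :: "('c::cstar_algebra \<Rightarrow> 'c) \<Rightarrow> 'c \<Rightarrow> 'c"
  where "jones_projection E = (\<lambda>z. E z)"

definition module_adjoint :: "('c::cstar_algebra \<Rightarrow> 'c) \<Rightarrow> ('c \<Rightarrow> 'c) \<Rightarrow> 'c \<Rightarrow> 'c"
  where "module_adjoint E T = (THE S. \<forall>x y. E (star (S x) * y) = E (star x * T y))"

text \<open>
  A list of pairs \<open>(a, b)\<close> encodes the linear combination of the \<open>a e b\<close>; the scalars
  are absorbed into the \<open>a\<close>'s.
\<close>

definition basic_sum :: "('c::cstar_algebra \<Rightarrow> 'c) \<Rightarrow> ('c \<times> 'c) list \<Rightarrow> 'c \<Rightarrow> 'c"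
  where "basic_sum E ps = (\<Sum>(a, b)\<leftarrow>ps. left_mult a \<circ> jones_projection E \<circ> left_mult b)"

definition basic_construction :: "('c::cstar_algebra \<Rightarrow> 'c) \<Rightarrow> ('c \<Rightarrow> 'c) set"
  where "basic_construction E = range (basic_sum E)"

definition dual_expectation :: "('c::cstar_algebra \<Rightarrow> 'c) \<Rightarrow> ('c \<Rightarrow> 'c) \<Rightarrow> 'c"
  where "dual_expectation E T =
    (THE c. \<exists>ps. T = basic_sum E ps \<and> c = (\<Sum>(a, b)\<leftarrow>ps. mult_inverse (cstar_index E) * a * b))"

definition dual_index :: "('c::cstar_algebra \<Rightarrow> 'c) \<Rightarrow> 'c \<Rightarrow> 'c"
  where "dual_index E =
    watatani_index (basic_construction E) (\<circ>) (module_adjoint E) (left_mult \<circ> dual_expectation E)"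

section \<open>The upward basic construction\<close>

text \<open>
  \<open>C \<otimes>\<^sub>A X \<otimes>\<^sub>B D~\<close> is the free abelian group on the triples \<open>(c, x, d)\<close>, standing for
  \<open>c \<otimes> x \<otimes> d~\<close>, modulo additivity in each entry and the balancing relations; the module
  structure of \<open>D~\<close> is \<open>b \<cdot> d~ = (d b*)~\<close>. Complex homogeneity is the case of scalar
  \<open>a \<in> A\<close>, \<open>b \<in> B\<close> of the balancing relations. No completion is needed: if \<open>us\<close>
  and \<open>vs\<close> are quasi-bases, every element is a sum of terms
  \<open>u\<^sub>i \<otimes> x\<^sub>i\<^sub>j \<otimes> v\<^sub>j~\<close>, so the algebraic tensor product is a direct summand of a finite direct
  sum of copies of \<open>X\<close> and hence complete.
\<close>

definition upward_relations ::
  "'c::cstar_algebra set \<Rightarrow> 'd::cstar_algebra set \<Rightarrow>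
   ('c \<Rightarrow> 'y::complex_banach \<Rightarrow> 'y) \<Rightarrow> ('y \<Rightarrow> 'd \<Rightarrow> 'y) \<Rightarrow> 'y set \<Rightarrow>
   ('c \<times> 'y \<times> 'd \<Rightarrow>\<^sub>0 int) set"
  where "upward_relations A B lact ract X =
    {frag_of (c + c', x, d) - frag_of (c, x, d) - frag_of (c', x, d) | c c' x d. x \<in> X} \<union>
    {frag_of (c, x + x', d) - frag_of (c, x, d) - frag_of (c, x', d) | c x x' d. x \<in> X \<and> x' \<in> X} \<union>
    {frag_of (c, x, d + d') - frag_of (c, x, d) - frag_of (c, x, d') | c x d d'. x \<in> X} \<union>
    {frag_of (c * a, x, d) - frag_of (c, lact a x, d) | c a x d. a \<in> A \<and> x \<in> X} \<union>
    {frag_of (c, ract x b, d) - frag_of (c, x, d * star b) | c x b d. b \<in> B \<and> x \<in> X}"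

definition upward_construction ::
  "'c::cstar_algebra set \<Rightarrow> 'd::cstar_algebra set \<Rightarrow>
   ('c \<Rightarrow> 'y::complex_banach \<Rightarrow> 'y) \<Rightarrow> ('y \<Rightarrow> 'd \<Rightarrow> 'y) \<Rightarrow> 'y set \<Rightarrow>
   ('c \<times> 'y \<times> 'd \<Rightarrow>\<^sub>0 int) set monoid"
  where "upward_construction A B lact ract X =
    (let F = free_Abelian_group (UNIV \<times> X \<times> UNIV)
     in F Mod generate F (upward_relations A B lact ract X))"

text \<open>An element of \<open>Y\<^sub>1\<close> is a coset of formal sums; \<open>tensor_class\<close> is the coset of a formal sum.\<close>

definition tensor_class ::
  "('c \<times> 'y \<times> 'd \<Rightarrow>\<^sub>0 int) set monoid \<Rightarrow> ('c \<times> 'y \<times> 'd \<Rightarrow>\<^sub>0 int) \<Rightarrow> ('c \<times> 'y \<times> 'd \<Rightarrow>\<^sub>0 int) set"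
  where "tensor_class Y\<^sub>1 f = (THE \<xi>. \<xi> \<in> carrier Y\<^sub>1 \<and> f \<in> \<xi>)"

definition upward_lact ::
  "('c \<times> 'y \<times> 'd \<Rightarrow>\<^sub>0 int) set monoid \<Rightarrow> ('c \<Rightarrow> 'c) \<Rightarrow>
   ('c \<times> 'y \<times> 'd \<Rightarrow>\<^sub>0 int) set \<Rightarrow> ('c \<times> 'y \<times> 'd \<Rightarrow>\<^sub>0 int) set"
  where "upward_lact Y\<^sub>1 T \<xi> =
    (\<Union>f\<in>\<xi>. tensor_class Y\<^sub>1 (frag_extend (\<lambda>(c, x, d). frag_of (T c, x, d)) f))"

text \<open>On the dual module \<open>D~\<close> an operator \<open>S \<in> D\<^sub>1\<close> acts by \<open>d~ \<cdot> S = (S* d)~\<close>.\<close>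

definition upward_ract ::
  "('d::cstar_algebra \<Rightarrow> 'd) \<Rightarrow> ('c \<times> 'y \<times> 'd \<Rightarrow>\<^sub>0 int) set monoid \<Rightarrow>
   ('c \<times> 'y \<times> 'd \<Rightarrow>\<^sub>0 int) set \<Rightarrow> ('d \<Rightarrow> 'd) \<Rightarrow> ('c \<times> 'y \<times> 'd \<Rightarrow>\<^sub>0 int) set"
  where "upward_ract E\<^sub>B Y\<^sub>1 \<xi> S =
    (\<Union>f\<in>\<xi>. tensor_class Y\<^sub>1 (frag_extend (\<lambda>(c, x, d). frag_of (c, x, module_adjoint E\<^sub>B S d)) f))"

definition upward_inclusion ::
  "('c::cstar_algebra \<Rightarrow> 'y::complex_banach \<Rightarrow> 'y) \<Rightarrow> ('y \<Rightarrow> 'd::cstar_algebra \<Rightarrow> 'y) \<Rightarrow> ('y \<Rightarrow> 'y) \<Rightarrow>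
   'c list \<Rightarrow> 'd list \<Rightarrow> ('c \<times> 'y \<times> 'd \<Rightarrow>\<^sub>0 int) set monoid \<Rightarrow>
   'y \<Rightarrow> ('c \<times> 'y \<times> 'd \<Rightarrow>\<^sub>0 int) set"
  where "upward_inclusion lact ract E\<^sub>X us vs Y\<^sub>1 y =
    tensor_class Y\<^sub>1 (\<Sum>u\<leftarrow>us. \<Sum>v\<leftarrow>vs. frag_of (u, E\<^sub>X (ract (lact (star u) y) v), v))"

definition upward_expectation ::
  "('c::cstar_algebra \<Rightarrow> 'y::complex_banach \<Rightarrow> 'y) \<Rightarrow> ('y \<Rightarrow> 'd::cstar_algebra \<Rightarrow> 'y) \<Rightarrow> ('c \<Rightarrow> 'c) \<Rightarrow>
   ('c \<times> 'y \<times> 'd \<Rightarrow>\<^sub>0 int) set \<Rightarrow> 'y"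
  where "upward_expectation lact ract E\<^sub>A \<xi> =
    (THE y. \<exists>f\<in>\<xi>. y = (\<Sum>(c, x, d)\<in>Poly_Mapping.keys f.
       of_int (Poly_Mapping.lookup f (c, x, d)) *\<^sub>R
         lact (mult_inverse (cstar_index E\<^sub>A)) (ract (lact c x) (star d))))"

end

theory Submission
  imports Defs
begin

text \<open>
  Let \<open>\<phi>\<close> denote the inclusion of \<open>Y\<close> into \<open>Y\<^sub>1\<close> and \<open>e\<^sub>A\<close>, \<open>e\<^sub>B\<close> the Jones projections. Everything
  follows from the action of the Jones projections on \<open>\<phi>(y) = \<Sum> u \<otimes> E\<^sub>X(u* y v) \<otimes> v~\<close>. As the values of
  \<open>E\<^sub>A\<close> can be moved across the tensor sign and \<open>\<Sum> E\<^sub>A(u) u* = 1\<close>, the projection \<open>e\<^sub>A\<close> removes the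
  sum over \<open>u\<close>:
  \<open>e\<^sub>A \<phi>(y) = \<Sum> 1 \<otimes> E\<^sub>X(y v) \<otimes> v~\<close>. In the same way
  \<open>\<phi>(y) e\<^sub>B = \<Sum> u \<otimes> E\<^sub>X(u* y) \<otimes> 1~\<close> and \<open>e\<^sub>A \<phi>(y) e\<^sub>B = 1 \<otimes> E\<^sub>X(y) \<otimes> 1~\<close>. The dual expectation sends
  the last element to \<open>k\<^bsup>-1\<^esup> E\<^sub>X(y)\<close>, where \<open>k\<close> is the index of \<open>E\<^sub>A\<close>; this is the formula for \<open>E\<^sub>X\<close>
  (lemma \<open>upward_expectation_compression\<close>), provided that \<open>k\<close> is also the index of the dual
  expectation of \<open>E\<^sub>A\<close> (lemma \<open>dual_index_eq\<close>).

  For \<open>x\<close> in \<open>X\<close> both \<open>e\<^sub>A \<phi>(x)\<close> and \<open>\<phi>(x) e\<^sub>B\<close> equal \<open>1 \<otimes> x \<otimes> 1~\<close> (lemma \<open>X_commutes\<close>). Conversely, the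
  map \<open>c \<otimes> x \<otimes> d~ \<mapsto> E\<^sub>A(c) x d*\<close> is well defined on \<open>Y\<^sub>1\<close> and sends \<open>e\<^sub>A \<phi>(y)\<close> to
  \<open>\<Sum> E\<^sub>X(y v) v* = y\<close> but \<open>\<phi>(y) e\<^sub>B\<close> to \<open>E\<^sub>X(y)\<close>; so if the two agree then \<open>y\<close> lies in \<open>X\<close>
  (lemma \<open>commutes_imp_X\<close>). Since an element of \<open>Y\<^sub>1\<close> is a coset of formal sums, these computations are
  carried out with representatives modulo the tensor relations, and the maps from \<open>Y\<^sub>1\<close> to \<open>Y\<close> are
  evaluations of formal sums that vanish on the relations.

  The analytic input is that the index \<open>k = \<Sum> u u*\<close> is invertible. The identity
  \<open>\<Sum> u E\<^sub>A(u*) = 1\<close> gives a right inverse for the row of the \<open>u\<close>, and in a C*-algebra this forces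
  \<open>\<Sum> u u*\<close> to be invertible (lemma \<open>row_with_right_inverse_has_inverse\<close>), because the norm is monotone on
  sums of positive elements. Monotonicity rests on two classical facts: the norm of a selfadjoint
  element is determined by its spectrum (lemma \<open>selfadjoint_unit_extreme\<close>), and \<open>b* b\<close> has
  non-negative spectrum (lemma \<open>nonneg_spectrum_star_mult\<close>). Both are proved from the Neumann series and
  the C*-identity, without functional calculus.
\<close>

section \<open>Inverses and selfadjoint elements in a unital C*-algebra\<close>

definition is_inverse :: "'a::cstar_algebra \<Rightarrow> 'a \<Rightarrow> bool"
  where "is_inverse a b \<longleftrightarrow> a * b = 1 \<and> b * a = 1"

definition has_inverse :: "'a::cstar_algebra \<Rightarrow> bool"
  where "has_inverse a \<longleftrightarrow> (\<exists>b. is_inverse a b)"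

lemma is_inverseD:
  assumes "is_inverse a b"
  shows "a * b = 1" "b * a = 1" "a * (b * x) = x" "b * (a * x) = x"
  using assms by (simp_all add: is_inverse_def flip: mult.assoc)

lemma is_inverse_unique: "is_inverse a b \<Longrightarrow> is_inverse a c \<Longrightarrow> b = c"
  using is_inverseD(3)[of c a b] by (simp add: is_inverse_def)

lemma mult_inverse_eqI: "is_inverse a b \<Longrightarrow> mult_inverse a = b"
  unfolding mult_inverse_def
  using is_inverse_unique[unfolded is_inverse_def] by (intro the_equality) (auto simp: is_inverse_def)

lemma is_inverse_mult_inverse: "has_inverse a \<Longrightarrow> is_inverse a (mult_inverse a)"
  unfolding has_inverse_def using mult_inverse_eqI by blast

lemma is_inverse_mult: "is_inverse a b \<Longrightarrow> is_inverse c d \<Longrightarrow> is_inverse (a * c) (d * b)"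
  unfolding is_inverse_def[of "a * c"] by (simp add: mult.assoc is_inverseD)

lemma has_inverse_mult: "has_inverse a \<Longrightarrow> has_inverse b \<Longrightarrow> has_inverse (a * b)"
  unfolding has_inverse_def using is_inverse_mult by blast

lemma is_inverse_scaleC: "is_inverse a b \<Longrightarrow> z \<noteq> 0 \<Longrightarrow> is_inverse (z *\<^sub>C a) (inverse z *\<^sub>C b)"
  by (simp add: is_inverse_def mult_scaleC_left mult_scaleC_right scaleC_scaleC scaleC_one)

lemma is_inverse_scaleR: "is_inverse a b \<Longrightarrow> t \<noteq> 0 \<Longrightarrow> is_inverse (t *\<^sub>R a) (inverse t *\<^sub>R b)"
  by (simp add: is_inverse_def)

lemma has_inverse_scaleR: "has_inverse a \<Longrightarrow> t \<noteq> 0 \<Longrightarrow> has_inverse (t *\<^sub>R a)"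
  unfolding has_inverse_def using is_inverse_scaleR by blast

lemma star_zero [simp]: "star (0::'a::cstar_algebra) = 0"
  using star_add[of "0::'a" 0] by simp

lemma star_minus: "star (- x) = - star (x::'a::cstar_algebra)"
  using star_add[of x "- x"] by (simp add: eq_neg_iff_add_eq_0 add.commute)

lemma star_diff: "star (x - y) = star x - star (y::'a::cstar_algebra)"
  using star_add[of x "- y"] by (simp add: star_minus)

lemma star_one [simp]: "star (1::'a::cstar_algebra) = 1"
  using star_mult[of "star (1::'a)" 1] by (simp add: star_star)

lemma star_scaleR: "star (t *\<^sub>R x) = t *\<^sub>R star (x::'a::cstar_algebra)"
  by (simp add: scaleR_scaleC star_scaleC)

lemma star_sum_list: "star (\<Sum>x\<leftarrow>xs. f x) = (\<Sum>x\<leftarrow>xs. star (f x :: 'a::cstar_algebra))"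
  by (induction xs) (simp_all add: star_add)

lemma star_power: "star (x ^ n) = star (x::'a::cstar_algebra) ^ n"
  by (induction n) (simp_all add: star_mult power_commutes)

lemmas star_simps = star_add star_minus star_diff star_mult star_star star_scaleR star_scaleC

lemma is_inverse_star: "is_inverse a b \<Longrightarrow> is_inverse (star a) (star b)"
  unfolding is_inverse_def by (simp flip: star_mult)

lemma norm_star [simp]: "norm (star x) = norm (x::'a::cstar_algebra)"
proof -
  have le: "norm y \<le> norm (star y)" for y :: 'a
  proof (cases "norm y = 0")
    case False
    have "norm y * norm y \<le> norm (star y) * norm y"
      using norm_mult_ineq[of "star y" y] by (simp add: cstar_identity power2_eq_square)
    with False show ?thesis by simp
  qed simp
  show ?thesis using le[of x] le[of "star x"] by (simp add: star_star)
qed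

lemma norm_selfadjoint_square: "star h = h \<Longrightarrow> norm (h * h) = (norm (h::'a::cstar_algebra))\<^sup>2"
  using cstar_identity[of h] by simp

lemma norm_one_le: "norm (1::'a::cstar_algebra) \<le> 1"
proof -
  have "norm (1::'a) = (norm (1::'a))\<^sup>2"
    using cstar_identity[of "1::'a"] by simp
  then show ?thesis by (cases "norm (1::'a) = 0") (simp_all add: power2_eq_square)
qed

lemma norm_power_le: "norm (x ^ n) \<le> norm (x::'a::cstar_algebra) ^ n"
proof (induction n)
  case (Suc n)
  then show ?case
    using norm_mult_ineq[of x "x ^ n"] mult_left_mono[OF Suc norm_ge_zero[of x]] by simp
qed (simp add: norm_one_le)

lemma norm_mult_le: "norm x \<le> a \<Longrightarrow> norm y \<le> b \<Longrightarrow> norm (x * y) \<le> a * b" for x :: "'a::cstar_algebra"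
  using norm_mult_ineq[of x y] mult_mono[of "norm x" a "norm y" b]
  by (meson norm_ge_zero order_trans)

lemma neumann_series:
  fixes x :: "'a::cstar_algebra"
  assumes "norm x < 1"
  shows "has_inverse (1 - x)"
proof -
  define S where "S = suminf (\<lambda>n. x ^ n)"
  have sm: "summable (\<lambda>n. x ^ n)"
    by (rule summable_comparison_test[of _ "\<lambda>n. norm x ^ n"])
       (use assms in \<open>auto intro: norm_power_le summable_geometric\<close>)
  have s1: "suminf (\<lambda>n. x ^ Suc n) = S - 1"
    using suminf_split_head[OF sm] by (simp add: S_def)
  have "suminf (\<lambda>n. x * x ^ n) = x * S" "suminf (\<lambda>n. x ^ n * x) = S * x"
    using suminf_mult[OF sm] suminf_mult2[OF sm] by (simp_all add: S_def)
  then have "x * S = S - 1" "S * x = S - 1"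
    using s1 by (simp_all add: power_commutes)
  then show ?thesis
    unfolding has_inverse_def is_inverse_def
    by (intro exI[of _ S]) (simp add: algebra_simps)
qed

text \<open>
  The set of invertible elements is open, with a radius that depends only on the norm of the
  inverse. All continuation arguments below rest on this and on a bound for the inverse.
\<close>

lemma inverse_perturbation:
  fixes a :: "'a::cstar_algebra"
  assumes ab: "is_inverse a b" and small: "norm d * norm b < 1"
  shows "has_inverse (a - d)"
proof -
  have "norm (b * d) < 1"
    using norm_mult_ineq[of b d] small by (simp add: mult.commute)
  then have "has_inverse (a * (1 - b * d))"
    using ab by (intro has_inverse_mult neumann_series) (auto simp: has_inverse_def)
  moreover have "a * (1 - b * d) = a - d"
    using ab by (simp add: right_diff_distrib is_inverseD)
  ultimately show ?thesis by simp
qed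

lemma inverse_perturbation_bound:
  fixes a :: "'a::cstar_algebra"
  assumes ab: "is_inverse a b" and ac: "is_inverse (a - d) c" and small: "norm d * norm b \<le> 1 / 2"
  shows "norm c \<le> 2 * norm b"
proof -
  have "b * ((a - d) * c) = b"
    using ac by (simp add: is_inverseD)
  then have "c = b + b * d * c"
    using ab by (simp add: algebra_simps is_inverseD)
  then have "norm c \<le> norm b + norm (b * d * c)"
    using norm_triangle_ineq[of b "b * d * c"] by simp
  also have "norm (b * d * c) \<le> 1 / 2 * norm c"
    using norm_mult_ineq[of b d] small
    by (intro norm_mult_le order.refl) (simp add: mult.commute)
  finally show ?thesis by simp
qed

lemma has_inverse_scalar_minus:
  fixes x :: "'a::cstar_algebra"
  assumes "norm x < t"
  shows "has_inverse (t *\<^sub>R 1 - x)"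
proof -
  have t: "t > 0" using assms norm_ge_zero[of x] by linarith
  have "has_inverse (t *\<^sub>R (1 - (1 / t) *\<^sub>R x))"
    using t assms by (intro has_inverse_scaleR neumann_series) auto
  then show ?thesis using t by (simp add: scaleR_diff_right)
qed

lemma has_inverse_scalar_plus:
  fixes x :: "'a::cstar_algebra"
  assumes "norm x < t"
  shows "has_inverse (t *\<^sub>R 1 + x)"
  using has_inverse_scalar_minus[of "- x" t] assms by simp

lemma scaleC_of_real_one: "complex_of_real t *\<^sub>C x = t *\<^sub>R (x::'a::complex_vector)"
  by (simp add: scaleR_scaleC)

lemma scaleC_eq: "z *\<^sub>C x = Re z *\<^sub>R x + Im z *\<^sub>R (\<i> *\<^sub>C (x::'a::complex_vector))"
proof -
  have "z = complex_of_real (Re z) + complex_of_real (Im z) * \<i>"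
    by (simp add: complex_eq mult.commute)
  then have "z *\<^sub>C x = (complex_of_real (Re z) + complex_of_real (Im z) * \<i>) *\<^sub>C x" by simp
  then show ?thesis by (simp only: scaleC_add_left scaleR_scaleC scaleC_scaleC)
qed

lemmas scaleC_simps = scaleC_add_right scaleC_add_left scaleC_scaleC scaleC_one
  complex_vector.scale_minus_left complex_vector.scale_minus_right
  complex_vector.scale_left_diff_distrib complex_vector.scale_right_diff_distrib
  mult_scaleC_left mult_scaleC_right

text \<open>
  Arens' trick. After an affine change \<open>z\<close> is the imaginary unit \<open>i\<close>. Adding a large imaginary
  multiple \<open>i s\<close> lengthens a selfadjoint element \<open>g\<close> only to second order,
  \<open>\<parallel>g + i s\<parallel>\<^sup>2 = \<parallel>g\<^sup>2 + s\<^sup>2\<parallel>\<close>, so \<open>\<parallel>g + i s\<parallel> < 1 + s\<close>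
  already for \<open>s = \<parallel>g\<parallel>\<^sup>2\<close>, and \<open>g - i\<close> is \<open>g + i s\<close> minus the larger scalar
  \<open>i (1 + s)\<close>.
\<close>

lemma selfadjoint_minus_nonreal_has_inverse:
  fixes h :: "'a::cstar_algebra"
  assumes h: "star h = h" and z: "Im z \<noteq> 0"
  shows "has_inverse (h - z *\<^sub>C 1)"
proof -
  define g where "g = (1 / Im z) *\<^sub>R (h - Re z *\<^sub>R 1)"
  have g: "star g = g" by (simp add: g_def star_simps h)
  define s where "s = (norm g)\<^sup>2"
  define J where "J = \<i> *\<^sub>C (1::'a)"
  have J: "g * J = J * g" "J * J = - 1" "star J = - J"
    by (simp_all add: J_def scaleC_simps star_simps)
  have "(norm (g + s *\<^sub>R J))\<^sup>2 = norm (star (g + s *\<^sub>R J) * (g + s *\<^sub>R J))"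
    by (simp add: cstar_identity)
  also have "star (g + s *\<^sub>R J) * (g + s *\<^sub>R J) = g * g + (s * s) *\<^sub>R 1"
    by (simp add: star_add star_scaleR g J left_diff_distrib distrib_left scaleR_add_right scaleR_diff_right)
  also have "norm \<dots> \<le> (norm g)\<^sup>2 + s\<^sup>2"
  proof -
    have "norm ((s * s) *\<^sub>R (1::'a)) \<le> s\<^sup>2"
      using mult_left_mono[OF norm_one_le, of "s * s"] by (simp add: power2_eq_square)
    then show ?thesis
      using norm_triangle_ineq[of "g * g" "(s * s) *\<^sub>R 1"] norm_selfadjoint_square[OF g] by linarith
  qed
  also have "\<dots> < (1 + s)\<^sup>2"
    by (simp add: s_def power2_eq_square algebra_simps add_pos_nonneg)
  finally have less: "norm (g + s *\<^sub>R J) < 1 + s"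
    by (rule power2_less_imp_less) (simp add: s_def)
  have J1: "is_inverse J (- J)"
    by (simp add: is_inverse_def J)
  have "has_inverse (J * ((1 + s) *\<^sub>R 1 + J * (g + s *\<^sub>R J)))"
  proof -
    have "norm (J * (g + s *\<^sub>R J)) < 1 + s" using less
      by (simp add: J_def mult_scaleC_left norm_scaleC)
    from has_inverse_scalar_plus[OF this] show ?thesis
      using J1 by (intro has_inverse_mult) (auto simp: has_inverse_def)
  qed
  moreover have "J * ((1 + s) *\<^sub>R 1 + J * (g + s *\<^sub>R J)) = - (g - J)"
  proof -
    have "J * (J * x) = - x" for x by (simp add: J flip: mult.assoc)
    then show ?thesis by (simp add: distrib_left scaleR_left_distrib J)
  qed
  ultimately have "has_inverse ((- Im z) *\<^sub>R - (g - J))"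
    using z by (intro has_inverse_scaleR) auto
  moreover have "(- Im z) *\<^sub>R - (g - J) = h - z *\<^sub>C 1"
    using z by (simp add: g_def scaleC_eq[of z 1] algebra_simps J_def)
  ultimately show ?thesis by simp
qed

lemma resolvent_identity: "is_inverse a r \<Longrightarrow> is_inverse b s \<Longrightarrow> r - s = r * (b - a) * s"
  by (simp add: right_diff_distrib left_diff_distrib mult.assoc is_inverseD)

text \<open>
  The resolvent identity for \<open>r\<close> and \<open>r*\<close> gives \<open>r - r* = 2 i (Im z) r r*\<close>. The right side has
  norm \<open>2 \<bar>Im z\<bar> \<parallel>r\<parallel>\<^sup>2\<close> by the C*-identity, the left side at most \<open>2 \<parallel>r\<parallel>\<close>.
\<close>

lemma nonreal_resolvent_bound:
  fixes h :: "'a::cstar_algebra"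
  assumes h: "star h = h" and z: "Im z \<noteq> 0" and r: "is_inverse (h - z *\<^sub>C 1) r"
  shows "norm r \<le> 1 / \<bar>Im z\<bar>"
proof -
  have r': "is_inverse (h - cnj z *\<^sub>C 1) (star r)"
    using is_inverse_star[OF r] h by (simp add: star_simps)
  have "r - star r = r * ((h - cnj z *\<^sub>C 1) - (h - z *\<^sub>C 1)) * star r"
    by (rule resolvent_identity[OF r r'])
  also have "(h - cnj z *\<^sub>C 1) - (h - z *\<^sub>C 1) = (z - cnj z) *\<^sub>C 1"
    by (simp add: complex_vector.scale_left_diff_distrib)
  finally have "r - star r = (z - cnj z) *\<^sub>C (r * star r)"
    by (simp add: mult_scaleC_left mult_scaleC_right)
  then have "norm (r - star r) = cmod (z - cnj z) * (norm r)\<^sup>2"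
    using cstar_identity[of "star r"] by (simp add: norm_scaleC star_star)
  moreover have "cmod (z - cnj z) = 2 * \<bar>Im z\<bar>"
    by (simp add: complex_diff_cnj norm_mult)
  moreover have "norm (r - star r) \<le> 2 * norm r"
    using norm_triangle_ineq4[of r "star r"] by simp
  ultimately have *: "\<bar>Im z\<bar> * norm r * norm r \<le> 1 * norm r"
    by (simp add: power2_eq_square)
  have "\<bar>Im z\<bar> * norm r \<le> 1"
  proof (cases "norm r = 0")
    case False
    then show ?thesis using * by (simp only: mult_le_cancel_right) auto
  qed simp
  then show ?thesis using z by (simp add: field_simps)
qed

text \<open>
  Away from the real axis the bound comes from the imaginary part of \<open>1 / z\<close>; close to \<open>1\<close> and to
  \<open>-1\<close> the inverses at these two points are perturbed.
\<close>

lemma circle_resolvent_bounded: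
  fixes q :: "'a::cstar_algebra"
  assumes q: "star q = q" "norm q \<le> 1" and minus: "is_inverse (1 - q) a" and plus: "is_inverse (1 + q) b"
  obtains M where "M \<ge> 1" "\<And>z. cmod z = 1 \<Longrightarrow> \<exists>r. is_inverse (1 - z *\<^sub>C q) r \<and> norm r \<le> M"
proof -
  \<comment> \<open>The threshold \<open>1 / (4 N)\<close> for \<open>\<bar>Im z\<bar>\<close> is chosen such that below it \<open>z\<close> is within
    \<open>1 / (2 N)\<close> of \<open>1\<close> or \<open>-1\<close>, where the perturbation lemma still applies.\<close>
  define N where "N = max 1 (max (norm a) (norm b))"
  have N: "N \<ge> 1" "norm a \<le> N" "norm b \<le> N" by (auto simp: N_def)
  have "\<exists>r. is_inverse (1 - z *\<^sub>C q) r \<and> norm r \<le> 4 * N" if z: "cmod z = 1" for z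
  proof (cases "\<bar>Im z\<bar> * (4 * N) \<ge> 1")
    case True
    then have im: "Im (cnj z) \<noteq> 0" by auto
    obtain r where r: "is_inverse (q - cnj z *\<^sub>C 1) r"
      using selfadjoint_minus_nonreal_has_inverse[OF q(1) im] by (auto simp: has_inverse_def)
    have "z \<noteq> 0" using z by auto
    have zz: "z * cnj z = 1" using z by (simp flip: complex_norm_square)
    have "is_inverse ((- z) *\<^sub>C (q - cnj z *\<^sub>C 1)) (inverse (- z) *\<^sub>C r)"
      using r \<open>z \<noteq> 0\<close> by (intro is_inverse_scaleC) auto
    moreover have "(- z) *\<^sub>C (q - cnj z *\<^sub>C 1) = 1 - z *\<^sub>C q"
      by (simp add: scaleC_simps zz)
    moreover have "norm (inverse (- z) *\<^sub>C r) \<le> 4 * N"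
    proof -
      have "norm r \<le> 1 / \<bar>Im z\<bar>" using nonreal_resolvent_bound[OF q(1) im r] by simp
      also have "\<dots> \<le> 4 * N" using True im by (simp add: field_simps)
      finally show ?thesis using z by (simp add: norm_scaleC norm_inverse)
    qed
    ultimately show ?thesis by auto
  next
    case False
    define s where "s = (if Re z \<ge> 0 then 1 else - 1 :: real)"
    obtain c where c: "is_inverse (1 - s *\<^sub>R q) c" "norm c \<le> N"
      using minus plus N by (cases "Re z \<ge> 0") (auto simp: s_def)
    have circ: "(Re z)\<^sup>2 + (Im z)\<^sup>2 = 1" using z by (simp flip: cmod_power2)
    have re: "\<bar>Re z\<bar> \<le> 1" using abs_Re_le_cmod[of z] z by simp
    have "(Re z - s)\<^sup>2 + (Im z)\<^sup>2 = 2 - 2 * \<bar>Re z\<bar>"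
      using circ by (auto simp: s_def power2_eq_square algebra_simps)
    also have "\<dots> \<le> 4 * (Im z)\<^sup>2"
    proof -
      have "\<bar>Re z\<bar> * \<bar>Re z\<bar> \<le> \<bar>Re z\<bar> * 1" using re by (intro mult_left_mono) auto
      then show ?thesis using circ re by (simp add: power2_eq_square)
    qed
    finally have "(cmod (z - s))\<^sup>2 \<le> (2 * \<bar>Im z\<bar>)\<^sup>2"
      by (simp add: cmod_power2 power_mult_distrib)
    then have zs: "cmod (z - s) \<le> 2 * \<bar>Im z\<bar>"
      by (rule power2_le_imp_le) simp
    have "norm ((z - s) *\<^sub>C q) * norm c \<le> (2 * \<bar>Im z\<bar> * 1) * N"
      using zs q(2) c(2) unfolding norm_scaleC by (intro mult_mono) auto
    also have "\<dots> \<le> 1 / 2" using False by simp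
    finally have small: "norm ((z - s) *\<^sub>C q) * norm c \<le> 1 / 2" .
    have eq: "1 - s *\<^sub>R q - (z - s) *\<^sub>C q = 1 - z *\<^sub>C q"
      by (simp add: complex_vector.scale_left_diff_distrib scaleR_scaleC)
    obtain r where r: "is_inverse (1 - s *\<^sub>R q - (z - s) *\<^sub>C q) r"
      using inverse_perturbation[OF c(1)] small by (force simp: has_inverse_def)
    have "norm r \<le> 2 * norm c"
      by (rule inverse_perturbation_bound[OF c(1) r small])
    then show ?thesis using r c N unfolding eq by (intro exI[of _ r]) auto
  qed
  then show ?thesis using N(1) by (intro that[of "4 * N"]) auto
qed

section \<open>The norm of a selfadjoint element and its spectrum\<close>

text \<open>
  The inverses of \<open>1 - z x\<close> and \<open>1 - z y\<close> are compared with the same \<open>\<delta>\<close> on the whole unit circle.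
  This uniformity lets the estimate pass from \<open>x\<close>, \<open>y\<close> to their squares without any loss.
\<close>

definition close_resolvents :: "real \<Rightarrow> 'a::cstar_algebra \<Rightarrow> 'a \<Rightarrow> bool"
  where "close_resolvents \<delta> x y \<longleftrightarrow> (\<forall>z. cmod z = 1 \<longrightarrow>
    (\<exists>v w. is_inverse (1 - z *\<^sub>C x) v \<and> is_inverse (1 - z *\<^sub>C y) w \<and> norm (v - w) \<le> \<delta>))"

text \<open>
  The partial fraction decomposition \<open>1 / (1 - x\<^sup>2) = (1 / (1 - x) + 1 / (1 + x)) / 2\<close>.
\<close>

lemma inverse_one_minus_square:
  fixes x :: "'a::cstar_algebra"
  assumes v: "is_inverse (1 - x) v" and w: "is_inverse (1 + x) w"
  shows "is_inverse (1 - x * x) ((1 / 2) *\<^sub>R (v + w))"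
proof -
  have eq: "1 - x * x = (1 + x) * (1 - x)" "1 - x * x = (1 - x) * (1 + x)"
    by (simp_all add: algebra_simps)
  have "(1 - x * x) * v = 1 + x" unfolding eq(1) mult.assoc is_inverseD(1)[OF v] by simp
  moreover have "v * (1 - x * x) = 1 + x" unfolding eq(2) is_inverseD(4)[OF v] ..
  moreover have "(1 - x * x) * w = 1 - x" unfolding eq(2) mult.assoc is_inverseD(1)[OF w] by simp
  moreover have "w * (1 - x * x) = 1 - x" unfolding eq(1) is_inverseD(4)[OF w] ..
  ultimately have "(1 - x * x) * (v + w) = 1 + 1" "(v + w) * (1 - x * x) = 1 + 1"
    unfolding distrib_left[of _ v w] distrib_right[of v w] by simp_all
  then show ?thesis
    unfolding is_inverse_def mult_scaleR_left mult_scaleR_right by simp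
qed

lemma close_resolvents_square:
  assumes "close_resolvents \<delta> x y"
  shows "close_resolvents \<delta> (x * x) (y * y)"
  unfolding close_resolvents_def
proof (intro allI impI)
  fix z :: complex assume z: "cmod z = 1"
  define c where "c = csqrt z"
  have cc: "c * c = z" unfolding c_def using power2_csqrt[of z] by (simp add: power2_eq_square)
  have c1: "cmod c = 1" "cmod (- c) = 1" using z by (simp_all add: c_def)
  obtain v w where v: "is_inverse (1 - c *\<^sub>C x) v" "is_inverse (1 - c *\<^sub>C y) w" "norm (v - w) \<le> \<delta>"
    using assms c1 unfolding close_resolvents_def by blast
  obtain v' w' where v': "is_inverse (1 - (- c) *\<^sub>C x) v'" "is_inverse (1 - (- c) *\<^sub>C y) w'" "norm (v' - w') \<le> \<delta>"
    using assms c1 unfolding close_resolvents_def by blast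
  have "is_inverse (1 - z *\<^sub>C (x * x)) ((1 / 2) *\<^sub>R (v + v'))"
    using inverse_one_minus_square[of "c *\<^sub>C x"] v v' by (simp add: scaleC_simps cc)
  moreover have "is_inverse (1 - z *\<^sub>C (y * y)) ((1 / 2) *\<^sub>R (w + w'))"
    using inverse_one_minus_square[of "c *\<^sub>C y"] v v' by (simp add: scaleC_simps cc)
  moreover have "norm ((1 / 2) *\<^sub>R (v + v') - (1 / 2) *\<^sub>R (w + w')) \<le> \<delta>"
  proof -
    have "(1 / 2) *\<^sub>R (v + v') - (1 / 2) *\<^sub>R (w + w') = (1 / 2) *\<^sub>R ((v - w) + (v' - w'))"
      by (simp add: algebra_simps)
    then show ?thesis using norm_triangle_ineq[of "v - w" "v' - w'"] v v' by simp
  qed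
  ultimately show "\<exists>v w. is_inverse (1 - z *\<^sub>C (x * x)) v \<and> is_inverse (1 - z *\<^sub>C (y * y)) w \<and> norm (v - w) \<le> \<delta>"
    by blast
qed

lemma power_two_power_Suc: "x ^ (2 ^ Suc m) = x ^ (2 ^ m) * x ^ (2 ^ m)" for x :: "'a::monoid_mult"
  by (simp add: mult_2 power_add)

lemma close_resolvents_power:
  "close_resolvents \<delta> x y \<Longrightarrow> close_resolvents \<delta> (x ^ (2 ^ m)) (y ^ (2 ^ m))"
  by (induction m) (simp_all add: power_two_power_Suc close_resolvents_square del: power_Suc)

lemma norm_selfadjoint_power:
  fixes q :: "'a::cstar_algebra"
  assumes "star q = q"
  shows "norm (q ^ (2 ^ m)) = norm q ^ (2 ^ m)"
proof (induction m)
  case (Suc m)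
  have "star (q ^ (2 ^ m)) = q ^ (2 ^ m)" using assms by (simp add: star_power)
  from norm_selfadjoint_square[OF this] Suc show ?case
    by (simp only: power_two_power_Suc) (simp add: power2_eq_square)
qed simp

text \<open>
  The spectrum of a selfadjoint element of norm one contains \<open>1\<close> or \<open>-1\<close>. Otherwise the inverses
  of \<open>1 - z q\<close> are bounded on the unit circle, hence close to those of \<open>1 - z t q\<close> for \<open>t < 1\<close>
  near \<open>1\<close>. Repeated squaring keeps them equally close: the inverse of \<open>1 - q\<^sup>n\<close> is close to
  that of \<open>1 - t\<^sup>n q\<^sup>n\<close>, which tends to \<open>1\<close> as \<open>n\<close> runs through the powers of two. So \<open>q\<^sup>n\<close> is
  eventually short, while \<open>\<parallel>q\<^sup>n\<parallel> = 1\<close> for all these \<open>n\<close> by the C*-identity. This replaces the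
  spectral radius formula.
\<close>

lemma selfadjoint_unit_extreme:
  fixes q :: "'a::cstar_algebra"
  assumes q: "star q = q" "norm q = 1"
  shows "\<not> (has_inverse (1 - q) \<and> has_inverse (1 + q))"
proof
  assume "has_inverse (1 - q) \<and> has_inverse (1 + q)"
  then obtain a b where "is_inverse (1 - q) a" "is_inverse (1 + q) b" by (auto simp: has_inverse_def)
  then obtain M where M: "M \<ge> 1" "\<And>z. cmod z = 1 \<Longrightarrow> \<exists>r. is_inverse (1 - z *\<^sub>C q) r \<and> norm r \<le> M"
    using circle_resolvent_bounded[OF q(1)] q(2) by (metis order.refl)
  \<comment> \<open>With \<open>t = 1 - e\<close> the inverses of \<open>1 - z q\<close> and \<open>1 - z t q\<close> differ by at most
    \<open>M e (2 M) = 1 / 8\<close>.\<close>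
  define e where "e = 1 / (16 * M\<^sup>2)"
  have e: "0 < e" "e < 1" "e * M \<le> 1 / 2" "e * (2 * M\<^sup>2) \<le> 1 / 8"
  proof -
    have MM: "1 \<le> M * M" "1 * M \<le> M * M"
      using mult_mono[of 1 M 1 M] mult_right_mono[of 1 M M] M(1) by auto
    then have "1 < M * (M * 16)" by linarith
    then show "0 < e" "e < 1" "e * M \<le> 1 / 2" "e * (2 * M\<^sup>2) \<le> 1 / 8"
      using M(1) by (auto simp: e_def field_simps power2_eq_square)
  qed
  have close: "close_resolvents (1 / 8) q ((1 - e) *\<^sub>R q)"
    unfolding close_resolvents_def
  proof (intro allI impI)
    fix z :: complex assume z: "cmod z = 1"
    obtain v where v: "is_inverse (1 - z *\<^sub>C q) v" "norm v \<le> M" using M(2)[OF z] by blast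
    define d where "d = - (e *\<^sub>R (z *\<^sub>C q))"
    have d: "norm d = e" using z q(2) e by (simp add: d_def norm_scaleC)
    have eq: "1 - z *\<^sub>C q - d = 1 - z *\<^sub>C ((1 - e) *\<^sub>R q)"
      by (simp add: d_def scaleR_scaleC scaleC_simps left_diff_distrib right_diff_distrib mult.commute)
    have "norm d * norm v \<le> e * M"
      using v(2) e d by (simp add: mult_left_mono)
    with e have small: "norm d * norm v \<le> 1 / 2" by linarith
    then obtain w where w: "is_inverse (1 - z *\<^sub>C q - d) w"
      using inverse_perturbation[OF v(1), of d] by (force simp: has_inverse_def)
    have wM: "norm w \<le> 2 * M"
      using inverse_perturbation_bound[OF v(1) w small] v(2) by linarith
    have "v - w = v * ((1 - z *\<^sub>C q - d) - (1 - z *\<^sub>C q)) * w"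
      by (rule resolvent_identity[OF v(1) w])
    then have "norm (v - w) = norm (v * (- d) * w)" by simp
    also have "\<dots> \<le> M * e * (2 * M)"
      using v(2) wM d by (intro norm_mult_le) auto
    also have "\<dots> \<le> 1 / 8" using e(4) by (simp add: power2_eq_square mult_ac)
    finally show "\<exists>v w. is_inverse (1 - z *\<^sub>C q) v \<and> is_inverse (1 - z *\<^sub>C (1 - e) *\<^sub>R q) w \<and> norm (v - w) \<le> 1 / 8"
      using v w unfolding eq by blast
  qed
  obtain n where n: "(1 - e) ^ n < 1 / 16"
    using real_arch_pow_inv[of "1 / 16" "1 - e"] e by auto
  have "n \<le> 2 ^ n" by (simp add: less_imp_le)
  then have "(1 - e) ^ (2 ^ n) \<le> (1 - e) ^ n" using e by (intro power_decreasing) auto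
  then have n2: "(1 - e) ^ (2 ^ n) \<le> 1 / 16" using n by linarith
  define x where "x = q ^ (2 ^ n)"
  define y where "y = ((1 - e) *\<^sub>R q) ^ (2 ^ n)"
  have x1: "norm x = 1" using norm_selfadjoint_power[OF q(1)] q(2) by (simp add: x_def)
  have y1: "norm y \<le> 1 / 16"
    using norm_power_le[of "(1 - e) *\<^sub>R q" "2 ^ n"] n2 e q(2) by (simp add: y_def)
  obtain v w where v: "is_inverse (1 - x) v" and w: "is_inverse (1 - y) w" and vw: "norm (v - w) \<le> 1 / 8"
    using close_resolvents_power[OF close, of n] unfolding close_resolvents_def x_def[symmetric] y_def[symmetric]
    by (metis norm_one scaleC_one)
  have "w - 1 = y * w"
    using is_inverseD(1)[OF w] by (simp add: algebra_simps)
  have "norm y * norm (1::'a) \<le> 1 / 16 * 1"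
    using y1 norm_one_le by (intro mult_mono) auto
  then have "norm w \<le> 2 * norm (1::'a)"
    by (intro inverse_perturbation_bound[OF _ w]) (simp_all add: is_inverse_def)
  then have "norm w \<le> 2" using norm_one_le[where 'a='a] by linarith
  then have "norm (w - 1) \<le> 1 / 16 * 2"
    unfolding \<open>w - 1 = y * w\<close> using y1 by (intro norm_mult_le)
  then have v1: "norm (v - 1) \<le> 1 / 4"
    using norm_triangle_ineq[of "v - w" "w - 1"] vw by simp
  have "x = (1 - x) * (v - 1)"
    using is_inverseD(1)[OF v] by (simp add: algebra_simps)
  moreover have "norm ((1 - x) * (v - 1)) \<le> 2 * (1 / 4)"
    using v1 norm_triangle_ineq4[of 1 x] norm_one_le[where 'a='a] x1 by (intro norm_mult_le) auto
  ultimately show False using x1 by simp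
qed

text \<open>
  For selfadjoint elements the norm is controlled by the real spectrum. All norm estimates for
  positive elements are obtained through this lemma.
\<close>

lemma selfadjoint_norm_le:
  fixes h :: "'a::cstar_algebra"
  assumes h: "star h = h" and "r \<ge> 0"
    and inv: "\<And>t. t > r \<Longrightarrow> has_inverse (t *\<^sub>R 1 - h)" "\<And>t. t > r \<Longrightarrow> has_inverse (t *\<^sub>R 1 + h)"
  shows "norm h \<le> r"
proof (rule ccontr)
  assume "\<not> norm h \<le> r"
  then have t: "norm h > r" "norm h > 0" using assms(2) by auto
  define q where "q = (1 / norm h) *\<^sub>R h"
  have q: "star q = q" "norm q = 1" using t by (simp_all add: q_def star_simps h)
  have "has_inverse ((1 / norm h) *\<^sub>R (norm h *\<^sub>R 1 - h))" "has_inverse ((1 / norm h) *\<^sub>R (norm h *\<^sub>R 1 + h))"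
    using inv t by (auto intro!: has_inverse_scaleR)
  then have "has_inverse (1 - q)" "has_inverse (1 + q)"
    using t by (simp_all add: q_def scaleR_diff_right scaleR_add_right)
  then show False using selfadjoint_unit_extreme[OF q] by blast
qed

section \<open>Positivity of sums of squares\<close>

definition nonneg_spectrum :: "'a::cstar_algebra \<Rightarrow> bool"
  where "nonneg_spectrum h \<longleftrightarrow> star h = h \<and> (\<forall>a>0. has_inverse (h + a *\<^sub>R 1))"

lemma nonneg_spectrum_selfadjoint: "nonneg_spectrum h \<Longrightarrow> star h = h"
  by (simp add: nonneg_spectrum_def)

lemma nonneg_spectrum_has_inverse: "nonneg_spectrum h \<Longrightarrow> a > 0 \<Longrightarrow> has_inverse (h + a *\<^sub>R 1)"
  by (simp add: nonneg_spectrum_def)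

lemma nonneg_spectrumI_norm:
  fixes h :: "'a::cstar_algebra"
  assumes "star h = h" "norm (t *\<^sub>R 1 - h) \<le> t"
  shows "nonneg_spectrum h"
  unfolding nonneg_spectrum_def
proof (intro conjI allI impI)
  fix a :: real assume "a > 0"
  then have "has_inverse ((t + a) *\<^sub>R 1 - (t *\<^sub>R 1 - h))"
    using assms by (intro has_inverse_scalar_minus) auto
  then show "has_inverse (h + a *\<^sub>R 1)" by (simp add: algebra_simps)
qed (rule assms)

text \<open>
  With the preceding lemma this describes non-negative spectrum by a norm inequality, which is
  stable under sums because of the triangle inequality.
\<close>

lemma nonneg_spectrum_norm_complement:
  fixes h :: "'a::cstar_algebra"
  assumes h: "nonneg_spectrum h" and t: "norm h \<le> t"
  shows "norm (t *\<^sub>R 1 - h) \<le> t"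
proof (rule selfadjoint_norm_le)
  show "star (t *\<^sub>R 1 - h) = t *\<^sub>R 1 - h"
    using nonneg_spectrum_selfadjoint[OF h] by (simp add: star_simps)
  show t0: "t \<ge> 0" using t norm_ge_zero[of h] by linarith
  fix s assume s: "s > t"
  have "has_inverse (h + (s - t) *\<^sub>R 1)"
    using h s by (simp add: nonneg_spectrum_def)
  moreover have "h + (s - t) *\<^sub>R 1 = s *\<^sub>R 1 - (t *\<^sub>R 1 - h)" by (simp add: algebra_simps)
  ultimately show "has_inverse (s *\<^sub>R 1 - (t *\<^sub>R 1 - h))" by simp
  have "has_inverse ((s + t) *\<^sub>R 1 - h)"
    using s t t0 by (intro has_inverse_scalar_minus) auto
  then show "has_inverse (s *\<^sub>R 1 + (t *\<^sub>R 1 - h))" by (simp add: algebra_simps)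
qed

lemma nonneg_spectrum_add:
  assumes g: "nonneg_spectrum g" and h: "nonneg_spectrum h"
  shows "nonneg_spectrum (g + h)"
proof (rule nonneg_spectrumI_norm)
  show "star (g + h) = g + h"
    using g h by (simp add: nonneg_spectrum_def star_add)
  have eq: "(norm g + norm h) *\<^sub>R 1 - (g + h) = (norm g *\<^sub>R 1 - g) + (norm h *\<^sub>R 1 - h)"
    by (simp add: algebra_simps)
  then show "norm ((norm g + norm h) *\<^sub>R 1 - (g + h)) \<le> norm g + norm h"
    using norm_triangle_ineq[of "norm g *\<^sub>R 1 - g" "norm h *\<^sub>R 1 - h"]
      nonneg_spectrum_norm_complement[OF g order.refl] nonneg_spectrum_norm_complement[OF h order.refl]
    unfolding eq by linarith
qed

lemma nonneg_spectrum_zero: "nonneg_spectrum 0"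
  by (rule nonneg_spectrumI_norm[of _ 0]) simp_all

lemma nonneg_spectrum_sum_list:
  "(\<And>x. x \<in> set xs \<Longrightarrow> nonneg_spectrum (f x)) \<Longrightarrow> nonneg_spectrum (\<Sum>x\<leftarrow>xs. f x)"
  by (induction xs) (auto intro: nonneg_spectrum_zero nonneg_spectrum_add)

lemma nonneg_spectrum_scaleR:
  assumes "nonneg_spectrum h" "c > 0"
  shows "nonneg_spectrum (c *\<^sub>R h)"
  unfolding nonneg_spectrum_def
proof (intro conjI allI impI)
  fix a :: real assume "a > 0"
  then have "has_inverse (c *\<^sub>R (h + (a / c) *\<^sub>R 1))"
    using assms by (intro has_inverse_scaleR nonneg_spectrum_has_inverse) auto
  then show "has_inverse (c *\<^sub>R h + a *\<^sub>R 1)"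
    using assms by (simp add: scaleR_add_right)
qed (use assms in \<open>simp add: star_scaleR nonneg_spectrum_def\<close>)

lemma nonneg_spectrum_square:
  assumes x: "star x = x"
  shows "nonneg_spectrum (x * x)"
  unfolding nonneg_spectrum_def
proof (intro conjI allI impI)
  fix a :: real assume a: "a > 0"
  define z where "z = sqrt a * \<i>"
  have "Im z \<noteq> 0" "Im (- z) \<noteq> 0" using a by (simp_all add: z_def)
  then have "has_inverse ((x - z *\<^sub>C 1) * (x - (- z) *\<^sub>C 1))"
    by (intro has_inverse_mult selfadjoint_minus_nonreal_has_inverse x)
  moreover have "(x - z *\<^sub>C 1) * (x - (- z) *\<^sub>C 1) = x * x - (z * z) *\<^sub>C 1"
    by (simp add: left_diff_distrib right_diff_distrib distrib_left distrib_right scaleC_simps)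
  moreover have "z * z = complex_of_real (- a)"
    using a by (simp add: z_def complex_eq_iff)
  ultimately show "has_inverse (x * x + a *\<^sub>R 1)"
    by (simp only: scaleC_of_real_one) simp
qed (simp add: star_mult x)

lemma norm_le_norm_add:
  fixes p q :: "'a::cstar_algebra"
  assumes p: "nonneg_spectrum p" and q: "nonneg_spectrum q"
  shows "norm p \<le> norm (p + q)"
proof (rule selfadjoint_norm_le)
  define r where "r = norm (p + q)"
  have "nonneg_spectrum (r *\<^sub>R 1 - (p + q))"
  proof (rule nonneg_spectrumI_norm)
    show "star (r *\<^sub>R 1 - (p + q)) = r *\<^sub>R 1 - (p + q)"
      using p q by (simp add: star_simps nonneg_spectrum_def)
    show "norm (r *\<^sub>R 1 - (r *\<^sub>R 1 - (p + q))) \<le> r" by (simp only: r_def diff_diff_eq2) simp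
  qed
  from nonneg_spectrum_add[OF this q] have rp: "nonneg_spectrum (r *\<^sub>R 1 - p)" by simp
  fix t assume "t > norm (p + q)"
  then have t: "t - r > 0" "t > 0" using norm_ge_zero[of "p + q"] unfolding r_def by linarith+
  show "has_inverse (t *\<^sub>R 1 - p)"
    using nonneg_spectrum_has_inverse[OF rp t(1)] by (simp add: algebra_simps)
  show "has_inverse (t *\<^sub>R 1 + p)"
    using nonneg_spectrum_has_inverse[OF p t(2)] by (simp add: add.commute)
qed (use p in \<open>simp_all add: nonneg_spectrum_def\<close>)

lemma norm_le_norm_sum_list:
  assumes "\<And>x. x \<in> set xs \<Longrightarrow> nonneg_spectrum (f x)" "x \<in> set xs"
  shows "norm (f x) \<le> norm (\<Sum>x\<leftarrow>xs. f x)"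
  using assms
proof (induction xs)
  case (Cons y ys)
  have ys: "nonneg_spectrum (\<Sum>x\<leftarrow>ys. f x)" and y: "nonneg_spectrum (f y)"
    using Cons.prems by (auto intro: nonneg_spectrum_sum_list)
  show ?case
  proof (cases "x = y")
    case True
    then show ?thesis using norm_le_norm_add[OF y ys] by simp
  next
    case False
    then have "norm (f x) \<le> norm (\<Sum>x\<leftarrow>ys. f x)" using Cons by auto
    also have "\<dots> \<le> norm (\<Sum>x\<leftarrow>y # ys. f x)"
      using norm_le_norm_add[OF ys y] by (simp add: add.commute)
    finally show ?thesis .
  qed
qed simp

text \<open>
  The products \<open>x y\<close> and \<open>y x\<close> have the same spectrum outside zero; if \<open>r\<close> inverts
  \<open>t - x y\<close> then \<open>(1 + y r x) / t\<close> inverts \<open>t - y x\<close>.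
\<close>

lemma has_inverse_swap:
  fixes x y :: "'a::cstar_algebra"
  assumes "has_inverse (t *\<^sub>R 1 - x * y)" "t \<noteq> 0"
  shows "has_inverse (t *\<^sub>R 1 - y * x)"
proof -
  obtain r where r: "is_inverse (t *\<^sub>R 1 - x * y) r" using assms by (auto simp: has_inverse_def)
  have *: "b = a - 1" if "a - b = 1" for a b :: 'a
    unfolding that[symmetric] by simp
  have r1: "x * y * r = t *\<^sub>R r - 1" "r * (x * y) = t *\<^sub>R r - 1"
    using is_inverseD(1,2)[OF r] by (auto intro!: * simp: left_diff_distrib right_diff_distrib)
  have "y * x * (y * r * x) = y * (x * y * r) * x" "y * r * x * (y * x) = y * (r * (x * y)) * x"
    by (simp_all add: mult.assoc)
  then have "is_inverse (t *\<^sub>R 1 - y * x) ((1 / t) *\<^sub>R (1 + y * r * x))"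
    unfolding is_inverse_def r1 using assms(2)
    by (simp add: left_diff_distrib right_diff_distrib distrib_left distrib_right scaleR_add_right scaleR_diff_right)
  then show ?thesis by (auto simp: has_inverse_def)
qed

text \<open>
  With \<open>c\<close> split into its real and imaginary parts this is a sum of squares of selfadjoint
  elements.
\<close>

lemma nonneg_spectrum_star_mult_add:
  fixes c :: "'a::cstar_algebra"
  shows "nonneg_spectrum (star c * c + c * star c)"
proof -
  define x where "x = c + star c"
  define y where "y = \<i> *\<^sub>C (c - star c)"
  have "star x = x" "star y = y"
    by (simp_all add: x_def y_def star_simps add.commute scaleC_simps)
  then have "nonneg_spectrum ((1 / 2) *\<^sub>R (x * x + y * y))"
    by (intro nonneg_spectrum_scaleR nonneg_spectrum_add nonneg_spectrum_square) auto
  moreover have "x * x + y * y = 2 *\<^sub>R (star c * c + c * star c)"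
    by (simp add: x_def y_def scaleC_simps algebra_simps scaleR_2)
  ultimately show ?thesis by simp
qed

text \<open>
  Let \<open>h = b* b\<close>, \<open>c = b R\<close> and \<open>r = 1 - 2 a R = (h - a) / (h + a)\<close>. Then
  \<open>4 a c* c = 1 - r\<^sup>2\<close>, so \<open>c* c\<close> is bounded above by \<open>1 / (4 a)\<close>, and so is \<open>c c*\<close> because
  it has the same spectrum outside zero. As \<open>c* c + c c*\<close> is non-negative, \<open>c* c\<close> is bounded below
  by \<open>- 1 / (4 a)\<close>. This means \<open>r\<^sup>2 \<le> 2\<close>, which bounds \<open>r\<close> and hence \<open>R\<close>.
\<close>

lemma star_mult_resolvent_bound:
  fixes b :: "'a::cstar_algebra"
  assumes a: "a > 0" and R: "is_inverse (star b * b + a *\<^sub>R 1) R"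
  shows "norm R \<le> 3 / (2 * a)"
proof -
  have "star (star b * b + a *\<^sub>R 1) = star b * b + a *\<^sub>R 1" by (simp add: star_simps)
  then have sR: "star R = R" using is_inverse_unique[OF is_inverse_star[OF R]] R by simp
  define c where "c = b * R"
  define r where "r = 1 - (2 * a) *\<^sub>R R"
  have sr: "star r = r" by (simp add: r_def star_simps sR)
  have "star b * (b * R) = 1 - a *\<^sub>R R"
    using is_inverseD(1)[OF R] by (simp add: distrib_right eq_diff_eq mult.assoc)
  then have cc: "star c * c = R - a *\<^sub>R (R * R)"
    by (simp add: c_def star_mult sR mult.assoc right_diff_distrib)
  have rr: "r * r = 1 - (4 * a) *\<^sub>R (star c * c)"
  proof -
    define T where "T = (2 * a) *\<^sub>R R"
    have "(4 * a) *\<^sub>R (star c * c) = T + T - T * T"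
    proof -
      have "T + T = (4 * a) *\<^sub>R R" unfolding T_def scaleR_add_left[symmetric] by simp
      moreover have "T * T = (4 * a) *\<^sub>R (a *\<^sub>R (R * R))" by (simp add: T_def)
      ultimately show ?thesis unfolding cc scaleR_diff_right by simp
    qed
    moreover have "r = 1 - T" by (simp add: r_def T_def)
    ultimately show ?thesis
      by (simp add: left_diff_distrib right_diff_distrib)
  qed
  have P: "nonneg_spectrum (1 - (4 * a) *\<^sub>R (star c * c))"
    using nonneg_spectrum_square[OF sr] by (simp add: rr)
  have Q: "nonneg_spectrum (1 - (4 * a) *\<^sub>R (c * star c))"
    unfolding nonneg_spectrum_def
  proof (intro conjI allI impI)
    fix s :: real assume s: "s > 0"
    have eq: "1 - (4 * a) *\<^sub>R x + s *\<^sub>R 1 = (1 + s) *\<^sub>R 1 - (4 * a) *\<^sub>R x" for x :: 'a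
      by (simp add: scaleR_add_left)
    have "has_inverse ((1 + s) *\<^sub>R 1 - star c * ((4 * a) *\<^sub>R c))"
      using nonneg_spectrum_has_inverse[OF P s] unfolding eq mult_scaleR_right .
    then have "has_inverse ((1 + s) *\<^sub>R 1 - ((4 * a) *\<^sub>R c) * star c)"
      by (rule has_inverse_swap) (use s in simp)
    then show "has_inverse (1 - (4 * a) *\<^sub>R (c * star c) + s *\<^sub>R 1)"
      unfolding eq mult_scaleR_left .
  qed (simp only: star_diff star_scaleR star_mult star_star star_one)
  have "nonneg_spectrum ((1 - (4 * a) *\<^sub>R (c * star c)) + (4 * a) *\<^sub>R (star c * c + c * star c))"
    using a by (intro nonneg_spectrum_add[OF Q] nonneg_spectrum_scaleR[OF nonneg_spectrum_star_mult_add]) simp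
  then have S: "nonneg_spectrum (2 *\<^sub>R 1 - r * r)"
    by (simp add: rr scaleR_add_right scaleR_2 algebra_simps)
  have "norm (r * r) \<le> 2"
  proof (rule selfadjoint_norm_le)
    fix t :: real assume t: "t > 2"
    show "has_inverse (t *\<^sub>R 1 - r * r)"
      using nonneg_spectrum_has_inverse[OF S, of "t - 2"] t by (simp add: algebra_simps)
    show "has_inverse (t *\<^sub>R 1 + r * r)"
      using nonneg_spectrum_has_inverse[OF nonneg_spectrum_square[OF sr], of t] t by (simp add: add.commute)
  qed (simp_all add: star_mult sr)
  then have "(norm r)\<^sup>2 \<le> 2\<^sup>2" using norm_selfadjoint_square[OF sr] by simp
  then have "norm r \<le> 2" by (rule power2_le_imp_le) simp
  moreover have "norm ((2 * a) *\<^sub>R R) \<le> norm (1::'a) + norm r"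
    using norm_triangle_ineq4[of 1 r] by (simp add: r_def)
  ultimately have "2 * a * norm R \<le> 3" using a norm_one_le[where 'a='a] by simp
  then show ?thesis using a by (simp add: field_simps)
qed

text \<open>
  The resolvent \<open>(b* b + a)\<^bsup>-1\<^esup>\<close> exists for large \<open>a\<close>. By the preceding bound it can be continued
  from \<open>3 a / 2\<close> to \<open>a\<close>, and such steps reach every positive number.
\<close>

lemma nonneg_spectrum_star_mult:
  fixes b :: "'a::cstar_algebra"
  shows "nonneg_spectrum (star b * b)"
proof -
  define h where "h = star b * b"
  have reach: "has_inverse (h + a *\<^sub>R 1)" if "a \<ge> (2 / 3) ^ n * (norm h + 1)" for a n
    using that
  proof (induction n arbitrary: a)
    case 0
    then show ?case using has_inverse_scalar_plus[of h a] by (simp add: add.commute)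
  next
    case (Suc n)
    have a: "a > 0"
      using Suc.prems by (rule less_le_trans[rotated]) (simp add: add_nonneg_pos)
    have "has_inverse (h + (3 / 2 * a) *\<^sub>R 1)"
      by (rule Suc.IH) (use Suc.prems in simp)
    then obtain R where R: "is_inverse (h + (3 / 2 * a) *\<^sub>R 1) R" by (auto simp: has_inverse_def)
    have "norm R \<le> 3 / (2 * (3 / 2 * a))"
      using R a unfolding h_def by (intro star_mult_resolvent_bound[of _ b]) auto
    then have "norm ((a / 2) *\<^sub>R (1::'a)) * norm R \<le> (a / 2 * 1) * (1 / a)"
      using a norm_one_le[where 'a='a] by (intro mult_mono) (auto simp: mult_left_le)
    also have "\<dots> < 1" using a by simp
    finally have "has_inverse (h + (3 / 2 * a) *\<^sub>R 1 - (a / 2) *\<^sub>R 1)"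
      by (rule inverse_perturbation[OF R])
    moreover have "h + (3 / 2 * a) *\<^sub>R 1 - (a / 2) *\<^sub>R 1 = h + a *\<^sub>R 1"
      unfolding add_diff_eq[symmetric] scaleR_left_diff_distrib[symmetric] by simp
    ultimately show ?case by (simp only:)
  qed
  have "has_inverse (h + a *\<^sub>R 1)" if a: "a > 0" for a
  proof -
    have pos: "norm h + 1 > 0" by (simp add: add_nonneg_pos)
    obtain n where "(2 / 3) ^ n < a / (norm h + 1)"
      using real_arch_pow_inv[of "a / (norm h + 1)" "2 / 3"] a pos by auto
    then have "(2 / 3) ^ n * (norm h + 1) \<le> a" using pos by (simp add: field_simps)
    then show ?thesis by (rule reach)
  qed
  then show ?thesis by (simp add: nonneg_spectrum_def h_def star_simps)
qed

text \<open>
  Let \<open>k\<close> be the sum of the \<open>u u*\<close> and \<open>R\<close> the inverse of \<open>k + d\<close>. All summands of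
  \<open>R k R = \<Sum> (R u) (R u)*\<close> are positive and \<open>R k R \<le> R\<close>, so
  \<open>\<parallel>R u\<parallel>\<^sup>2 \<le> \<parallel>R\<parallel>\<close>. Since \<open>R = \<Sum> R u w(u)\<close>, this bounds \<open>\<parallel>R\<parallel>\<close> independently of \<open>d\<close>, and
  for small \<open>d\<close> the inverse persists when \<open>d\<close> is removed.
\<close>

lemma row_with_right_inverse_has_inverse:
  fixes us :: "'a::cstar_algebra list"
  assumes one: "(\<Sum>u\<leftarrow>us. u * w u) = 1"
  shows "has_inverse (\<Sum>u\<leftarrow>us. u * star u)"
proof -
  define k where "k = (\<Sum>u\<leftarrow>us. u * star u)"
  have pos: "nonneg_spectrum (x * star x)" for x :: 'a
    using nonneg_spectrum_star_mult[of "star x"] by (simp add: star_star)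
  have k: "nonneg_spectrum k"
    unfolding k_def by (intro nonneg_spectrum_sum_list pos)
  define W where "W = (\<Sum>u\<leftarrow>us. norm (w u))"
  have W: "W \<ge> 0" unfolding W_def by (intro sum_list_nonneg) auto
  \<comment> \<open>The norm of \<open>R\<close> will be at most \<open>W\<^sup>2\<close>, so that \<open>d \<parallel>R\<parallel> < 1\<close>.\<close>
  define d where "d = 1 / (W\<^sup>2 + 1)"
  have "W\<^sup>2 + 1 > 0" by (simp add: add_nonneg_pos)
  then have d: "d > 0" "d * W\<^sup>2 < 1"
    unfolding d_def by (simp_all add: field_simps)
  obtain R where R: "is_inverse (k + d *\<^sub>R 1) R"
    using nonneg_spectrum_has_inverse[OF k d(1)] by (auto simp: has_inverse_def)
  have "star (k + d *\<^sub>R 1) = k + d *\<^sub>R 1"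
    using nonneg_spectrum_selfadjoint[OF k] by (simp add: star_simps)
  then have sR: "star R = R" using is_inverse_unique[OF is_inverse_star[OF R]] R by simp
  have RkR: "(\<Sum>u\<leftarrow>us. (R * u) * star (R * u)) = R * k * R"
    unfolding k_def by (simp add: star_mult sR mult.assoc flip: sum_list_const_mult sum_list_mult_const)
  have "R * k * R + d *\<^sub>R (R * R) = R * (k + d *\<^sub>R 1) * R"
    by (simp add: distrib_left distrib_right)
  also have "\<dots> = R" using is_inverseD[OF R] by simp
  finally have split: "R * k * R + d *\<^sub>R (R * R) = R" .
  have "norm (R * k * R) \<le> norm R"
    using norm_le_norm_add[of "R * k * R" "d *\<^sub>R (R * R)"] d(1) unfolding split
    by (simp add: nonneg_spectrum_sum_list pos nonneg_spectrum_scaleR nonneg_spectrum_square sR flip: RkR)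
  have Ru: "norm (R * u) \<le> sqrt (norm R)" if "u \<in> set us" for u
  proof -
    have "(norm (R * u))\<^sup>2 = norm ((R * u) * star (R * u))"
      using cstar_identity[of "star (R * u)"] by (simp add: star_star)
    also have "\<dots> \<le> norm (R * k * R)"
      unfolding RkR[symmetric] using that by (intro norm_le_norm_sum_list[of us "\<lambda>u. (R * u) * star (R * u)"] pos)
    also have "\<dots> \<le> norm R" by fact
    finally show ?thesis by (simp add: real_le_rsqrt)
  qed
  have "R = (\<Sum>u\<leftarrow>us. R * u * w u)"
    using one by (simp add: mult.assoc sum_list_const_mult)
  then have "norm R = norm (\<Sum>u\<leftarrow>us. R * u * w u)" by simp
  also have "\<dots> \<le> (\<Sum>u\<leftarrow>us. norm (R * u * w u))"
    by (induction us) (auto intro: norm_triangle_le)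
  also have "\<dots> \<le> (\<Sum>u\<leftarrow>us. sqrt (norm R) * norm (w u))"
    using Ru by (intro sum_list_mono norm_mult_le) auto
  also have "\<dots> = sqrt (norm R) * W"
    by (simp add: W_def sum_list_const_mult)
  finally have "sqrt (norm R) * sqrt (norm R) \<le> sqrt (norm R) * W" by simp
  then have "sqrt (norm R) \<le> W"
    using W by (cases "norm R = 0") (simp_all only: mult_le_cancel_left, auto)
  then have "norm R \<le> W\<^sup>2" by (simp add: real_sqrt_le_iff sqrt_le_D)
  then have "norm (d *\<^sub>R (1::'a)) * norm R \<le> (d * 1) * W\<^sup>2"
    using d(1) norm_one_le[where 'a='a] by (intro mult_mono) (auto simp: mult_left_le)
  then have "norm (d *\<^sub>R (1::'a)) * norm R < 1" using d(2) by simp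
  from inverse_perturbation[OF R this] show ?thesis by (simp add: k_def)
qed

section \<open>Quasi-bases and the index\<close>

lemma sum_list_swap:
  "(\<Sum>x\<leftarrow>xs. \<Sum>y\<leftarrow>ys. f x y) = (\<Sum>y\<leftarrow>ys. \<Sum>x\<leftarrow>xs. f x y :: 'a::comm_monoid_add)"
  by (induction xs) (simp_all add: sum_list_addf)

lemma sum_list_apply: "(\<Sum>x\<leftarrow>xs. f x) z = (\<Sum>x\<leftarrow>xs. f x z)"
  by (induction xs) simp_all

lemma sum_list_pairs:
  "(\<Sum>w\<leftarrow>concat (map (\<lambda>x. map (g x) ys) xs). f w) = (\<Sum>x\<leftarrow>xs. \<Sum>y\<leftarrow>ys. f (g x y))"
  by (induction xs) (simp_all add: comp_def)

lemma clinear_add: "clinear f \<Longrightarrow> f (x + y) = f x + f y"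
  unfolding Vector_Spaces.linear_def module_hom_def module_hom_axioms_def by blast

lemma clinear_scaleC: "clinear f \<Longrightarrow> f (z *\<^sub>C x) = z *\<^sub>C f x"
  unfolding Vector_Spaces.linear_def module_hom_def module_hom_axioms_def by blast

lemma clinear_scaleR: "clinear f \<Longrightarrow> f (t *\<^sub>R x) = t *\<^sub>R f x"
  by (simp add: scaleR_scaleC clinear_scaleC)

lemma additive_zero:
  fixes f :: "'a::ab_group_add \<Rightarrow> 'b::ab_group_add"
  assumes "\<And>x y. f (x + y) = f x + f y"
  shows "f 0 = 0"
  using assms[of 0 0] by simp

lemma additive_sum_list:
  fixes f :: "'a::ab_group_add \<Rightarrow> 'b::ab_group_add"
  assumes "\<And>x y. f (x + y) = f x + f y"
  shows "f (\<Sum>x\<leftarrow>xs. g x) = (\<Sum>x\<leftarrow>xs. f (g x))"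
  using additive_zero[of f, OF assms] by (induction xs) (simp_all add: assms)

text \<open>
  The index does not depend on the quasi-basis: expand each \<open>v\<close> in \<open>\<Sum> v v*\<close> by the family
  \<open>us\<close>, and then collapse the sum over \<open>vs\<close> by the second quasi-basis identity. Additivity of the
  product is a hypothesis because the composition of arbitrary functions is additive on one side
  only.
\<close>

lemma watatani_index_eqI:
  fixes R :: "'r::comm_monoid_add set"
  assumes us: "quasi_basis R m st E us"
    and closed: "\<And>x. x \<in> R \<Longrightarrow> st x \<in> R" "\<And>x. x \<in> R \<Longrightarrow> E x \<in> R" "\<And>x y. x \<in> R \<Longrightarrow> y \<in> R \<Longrightarrow> m x y \<in> R"
    and assoc: "\<And>x y z. x \<in> R \<Longrightarrow> y \<in> R \<Longrightarrow> z \<in> R \<Longrightarrow> m (m x y) z = m x (m y z)"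
    and add: "\<And>x (xs :: 'r list) f. x \<in> R \<Longrightarrow> m x (\<Sum>y\<leftarrow>xs. f y) = (\<Sum>y\<leftarrow>xs. m x (f y))"
      "\<And>x (xs :: 'r list) f. x \<in> R \<Longrightarrow> m (\<Sum>y\<leftarrow>xs. f y) x = (\<Sum>y\<leftarrow>xs. m (f y) x)"
  shows "watatani_index R m st E = (\<Sum>u\<leftarrow>us. m u (st u))"
  unfolding watatani_index_def
proof (rule the_equality)
  show "\<exists>vs. quasi_basis R m st E vs \<and> (\<Sum>u\<leftarrow>us. m u (st u)) = (\<Sum>v\<leftarrow>vs. m v (st v))"
    using us by blast
  fix k assume "\<exists>vs. quasi_basis R m st E vs \<and> k = (\<Sum>v\<leftarrow>vs. m v (st v))"
  then obtain vs where vs: "quasi_basis R m st E vs" and k: "k = (\<Sum>v\<leftarrow>vs. m v (st v))" by blast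
  have inR: "u \<in> R" "v \<in> R" if "u \<in> set us" "v \<in> set vs" for u v
    using us vs that by (auto simp: quasi_basis_def)
  have "k = (\<Sum>v\<leftarrow>vs. m (\<Sum>u\<leftarrow>us. m u (E (m (st u) v))) (st v))"
    unfolding k using us vs by (intro arg_cong[where f = sum_list] map_cong) (auto simp: quasi_basis_def subset_iff)
  also have "\<dots> = (\<Sum>v\<leftarrow>vs. \<Sum>u\<leftarrow>us. m (m u (E (m (st u) v))) (st v))"
    using vs by (intro arg_cong[where f = sum_list] map_cong refl add(2) closed(1)) (auto simp: quasi_basis_def)
  also have "\<dots> = (\<Sum>v\<leftarrow>vs. \<Sum>u\<leftarrow>us. m u (m (E (m (st u) v)) (st v)))"
    using us vs
    by (intro arg_cong[where f = sum_list] map_cong refl assoc closed) (auto simp: quasi_basis_def)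
  also have "\<dots> = (\<Sum>u\<leftarrow>us. \<Sum>v\<leftarrow>vs. m u (m (E (m (st u) v)) (st v)))"
    by (rule sum_list_swap)
  also have "\<dots> = (\<Sum>u\<leftarrow>us. m u (\<Sum>v\<leftarrow>vs. m (E (m (st u) v)) (st v)))"
    using us by (intro arg_cong[where f = sum_list] map_cong refl add[symmetric]) (auto simp: quasi_basis_def)
  also have "\<dots> = (\<Sum>u\<leftarrow>us. m u (st u))"
    using us vs closed(1)
    by (intro arg_cong[where f = sum_list] map_cong refl arg_cong[where f = "m _"]) (auto simp: quasi_basis_def subset_iff)
  finally show "k = (\<Sum>u\<leftarrow>us. m u (st u))" .
qed

locale finite_index_expectation =
  fixes A :: "'c::cstar_algebra set" and E :: "'c \<Rightarrow> 'c" and us :: "'c list"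
  assumes inclusion: "unital_inclusion A"
    and expectation: "conditional_expectation A E"
    and quasi_basis: "cstar_quasi_basis E us"
    and index_in: "cstar_index E \<in> A"
begin

lemma star_in: "a \<in> A \<Longrightarrow> star a \<in> A"
  using inclusion by (auto simp: unital_inclusion_def)

lemma E_clinear: "clinear E" and E_in: "E c \<in> A" and E_fixes: "a \<in> A \<Longrightarrow> E a = a"
  and E_left: "a \<in> A \<Longrightarrow> E (a * c) = a * E c" and E_right: "a \<in> A \<Longrightarrow> E (c * a) = E c * a"
  using expectation unfolding conditional_expectation_def by auto

lemma E_add: "E (x + y) = E x + E y"
  by (rule clinear_add[OF E_clinear])

lemma E_sum_list: "E (\<Sum>x\<leftarrow>xs. f x) = (\<Sum>x\<leftarrow>xs. E (f x))"
  by (rule additive_sum_list) (rule E_add)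

lemma E_diff: "E (x - y) = E x - E y"
  using E_add[of "x - y" y] by simp

lemma E_products: "E (E a * b) = E a * E b" "E (a * E b) = E a * E b" "E (a * (b * E c)) = E (a * b) * E c"
  by (simp_all add: E_left E_right E_in flip: mult.assoc)

text \<open>
  A selfadjoint element is a difference of two positive ones, because
  \<open>4 h = (h + 1)\<^sup>2 - (h - 1)\<^sup>2\<close>, and a positive map sends positive elements to selfadjoint ones.
\<close>

lemma star_E_selfadjoint:
  assumes "star h = h"
  shows "star (E h) = E h"
proof -
  have pos: "star (E (star b * b)) = E (star b * b)" for b
  proof -
    have "positive (star b * b)" by (auto simp: positive_def)
    then have "positive (E (star b * b))"
      using expectation by (simp add: conditional_expectation_def)
    then show ?thesis by (auto simp: positive_def star_simps)
  qed
  have "star (h + 1) * (h + 1) - star (h - 1) * (h - 1) = 2 *\<^sub>R (2 *\<^sub>R h)"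
    using assms unfolding scaleR_2
    by (simp add: star_simps left_diff_distrib right_diff_distrib distrib_left distrib_right)
  then have "4 *\<^sub>R E h = E (star (h + 1) * (h + 1)) - E (star (h - 1) * (h - 1))"
    using clinear_scaleR[OF E_clinear] by (simp flip: E_diff)
  then have "star (4 *\<^sub>R E h) = 4 *\<^sub>R E h"
    using pos[of "h + 1"] pos[of "h - 1"] by (simp add: star_diff[of "E _"])
  then show ?thesis by (simp add: star_scaleR)
qed

lemma E_star: "E (star c) = star (E c)"
proof -
  define x where "x = c + star c"
  define y where "y = \<i> *\<^sub>C (c - star c)"
  have xy: "star x = x" "star y = y"
    by (simp_all add: x_def y_def star_simps add.commute scaleC_simps)
  have two: "2 *\<^sub>C z = z + z" for z :: 'c
    using scaleC_add_left[of 1 1 z] by (simp add: scaleC_one)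
  have c: "2 *\<^sub>C c = x - \<i> *\<^sub>C y" "2 *\<^sub>C star c = x + \<i> *\<^sub>C y"
    unfolding two by (simp_all add: x_def y_def scaleC_simps)
  have "2 *\<^sub>C E c = E x - \<i> *\<^sub>C E y" "2 *\<^sub>C E (star c) = E x + \<i> *\<^sub>C E y"
    unfolding clinear_scaleC[OF E_clinear, symmetric] c by (simp_all add: E_diff E_add)
  then have "star (2 *\<^sub>C E c) = 2 *\<^sub>C E (star c)"
    using xy[THEN star_E_selfadjoint] by (simp add: star_diff star_scaleC complex_vector.scale_minus_left)
  then show ?thesis by (simp add: star_scaleC)
qed

lemma quasi_basis_left: "(\<Sum>u\<leftarrow>us. u * E (star u * c)) = c"
  and quasi_basis_right: "(\<Sum>u\<leftarrow>us. E (c * u) * star u) = c"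
  using quasi_basis by (simp_all add: quasi_basis_def)

lemma quasi_basis_one: "(\<Sum>u\<leftarrow>us. u * star (E u)) = 1" "(\<Sum>u\<leftarrow>us. E u * star u) = 1"
  "(\<Sum>u\<leftarrow>us. u * E (star u)) = 1"
  using quasi_basis_left[of 1] quasi_basis_right[of 1] by (simp_all add: E_star)

lemma index_eq: "cstar_index E = (\<Sum>u\<leftarrow>us. u * star u)"
  by (rule watatani_index_eqI[OF quasi_basis])
     (auto simp: mult.assoc sum_list_const_mult sum_list_mult_const)

lemma index_central: "c * cstar_index E = cstar_index E * c"
proof -
  have "c * cstar_index E = (\<Sum>u\<leftarrow>us. c * u * star u)"
    by (simp add: index_eq sum_list_const_mult mult.assoc)
  also have "\<dots> = (\<Sum>u\<leftarrow>us. (\<Sum>v\<leftarrow>us. v * E (star v * (c * u))) * star u)"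
    by (simp only: quasi_basis_left)
  also have "\<dots> = (\<Sum>u\<leftarrow>us. \<Sum>v\<leftarrow>us. v * E (star v * (c * u)) * star u)"
    by (simp only: sum_list_mult_const)
  also have "\<dots> = (\<Sum>v\<leftarrow>us. \<Sum>u\<leftarrow>us. v * E (star v * (c * u)) * star u)"
    by (rule sum_list_swap)
  also have "\<dots> = (\<Sum>v\<leftarrow>us. v * (\<Sum>u\<leftarrow>us. E ((star v * c) * u) * star u))"
    by (simp only: sum_list_const_mult mult.assoc)
  also have "\<dots> = (\<Sum>v\<leftarrow>us. v * star v * c)"
    by (simp only: quasi_basis_right mult.assoc[symmetric])
  also have "\<dots> = cstar_index E * c"
    by (simp only: index_eq sum_list_mult_const)
  finally show ?thesis .
qed

text \<open>
  The quasi-basis identity for \<open>1\<close> says that the row of the \<open>u\<close> has a right inverse.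
\<close>

lemma index_is_inverse: "is_inverse (cstar_index E) (mult_inverse (cstar_index E))"
  unfolding index_eq
  by (rule is_inverse_mult_inverse[OF row_with_right_inverse_has_inverse[OF quasi_basis_one(3)]])

lemma index_inverse_central: "c * mult_inverse (cstar_index E) = mult_inverse (cstar_index E) * c"
proof -
  let ?k = "cstar_index E" and ?j = "mult_inverse (cstar_index E)"
  have "c * ?j = ?j * (?k * c) * ?j"
    by (simp add: mult.assoc is_inverseD[OF index_is_inverse])
  also have "\<dots> = ?j * c"
    by (simp add: mult.assoc is_inverseD[OF index_is_inverse] flip: index_central)
  finally show ?thesis .
qed

subsection \<open>The basic construction and its dual index\<close>

text \<open>
  The element \<open>a e b\<close> of the basic construction.
\<close>

definition rank_one :: "'c \<Rightarrow> 'c \<Rightarrow> 'c \<Rightarrow> 'c"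
  where "rank_one a b = (\<lambda>x. a * E (b * x))"

lemma basic_sum_apply: "basic_sum E ps x = (\<Sum>(a, b)\<leftarrow>ps. a * E (b * x))"
  unfolding basic_sum_def sum_list_apply
  by (intro arg_cong[where f = sum_list] map_cong) (auto simp: left_mult_def jones_projection_def)

lemma module_map_expand:
  assumes "\<And>x y. T (x + y) = T x + T y" "\<And>x a. a \<in> A \<Longrightarrow> T (x * a) = T x * a"
  shows "(\<Sum>u\<leftarrow>us. T u * E (star u * x)) = T x"
proof -
  have "T x = T (\<Sum>u\<leftarrow>us. u * E (star u * x))" by (simp only: quasi_basis_left)
  also have "\<dots> = (\<Sum>u\<leftarrow>us. T u * E (star u * x))"
    using assms E_in by (simp add: additive_sum_list)
  finally show ?thesis by simp
qed

text \<open>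
  A quasi-basis generates the module, so every right \<open>A\<close>-linear map \<open>T\<close> is the finite
  combination of the \<open>T(u) e u*\<close>. This description makes closure under composition evident.
\<close>

lemma basic_construction_iff:
  "T \<in> basic_construction E \<longleftrightarrow>
    (\<forall>x y. T (x + y) = T x + T y) \<and> (\<forall>x. \<forall>a\<in>A. T (x * a) = T x * a)"
proof
  assume "T \<in> basic_construction E"
  then obtain ps where T: "T = basic_sum E ps" by (auto simp: basic_construction_def)
  show "(\<forall>x y. T (x + y) = T x + T y) \<and> (\<forall>x. \<forall>a\<in>A. T (x * a) = T x * a)"
    unfolding T basic_sum_apply
    by (auto simp: distrib_left E_add E_right case_prod_unfold sum_list_addf sum_list_mult_const
        simp flip: mult.assoc)
next
  assume T: "(\<forall>x y. T (x + y) = T x + T y) \<and> (\<forall>x. \<forall>a\<in>A. T (x * a) = T x * a)"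
  have "T = basic_sum E (map (\<lambda>u. (T u, star u)) us)"
    using T module_map_expand[of T] by (intro ext) (simp add: basic_sum_apply comp_def)
  then show "T \<in> basic_construction E" unfolding basic_construction_def by blast
qed

lemma basic_construction_expand:
  assumes "T \<in> basic_construction E"
  shows "(\<Sum>u\<leftarrow>us. T u * E (star u * x)) = T x"
  using assms module_map_expand[of T] by (simp add: basic_construction_iff)

lemma module_adjointI:
  assumes "\<And>x y. E (star (S x) * y) = E (star x * T y)"
  shows "module_adjoint E T = S"
  unfolding module_adjoint_def
proof (rule the_equality)
  fix S' assume S': "\<forall>x y. E (star (S' x) * y) = E (star x * T y)"
  show "S' = S"
  proof
    fix x
    have "star (S' x) = (\<Sum>u\<leftarrow>us. E (star (S' x) * u) * star u)" by (simp only: quasi_basis_right)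
    also have "\<dots> = (\<Sum>u\<leftarrow>us. E (star (S x) * u) * star u)" using S' assms by simp
    also have "\<dots> = star (S x)" by (simp only: quasi_basis_right)
    finally show "S' x = S x" by (metis star_star)
  qed
qed (use assms in blast)

lemma module_adjoint_jones_projection: "module_adjoint E (jones_projection E) = jones_projection E"
  by (rule module_adjointI) (simp add: jones_projection_def E_left E_right E_in star_in flip: E_star)

lemma module_adjoint_rank_one: "module_adjoint E (rank_one a b) = rank_one (star b) (star a)"
  by (rule module_adjointI)
     (simp add: rank_one_def star_mult star_star E_products mult.assoc flip: E_star)

text \<open>
  The adjoint of \<open>T = \<Sum> T(u) e u*\<close> is \<open>\<Sum> u e T(u)*\<close>.
\<close>

lemma module_adjoint_in:
  assumes T: "T \<in> basic_construction E"
  shows "module_adjoint E T \<in> basic_construction E"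
proof -
  define S where "S = (\<lambda>x. \<Sum>u\<leftarrow>us. u * E (star (T u) * x))"
  have "module_adjoint E T = S"
  proof (rule module_adjointI)
    fix x y
    have "E (star (S x) * y) = (\<Sum>u\<leftarrow>us. E (E (star x * T u) * (star u * y)))"
      unfolding S_def star_sum_list sum_list_mult_const[symmetric] E_sum_list
      by (simp add: star_mult star_star mult.assoc flip: E_star)
    also have "\<dots> = (\<Sum>u\<leftarrow>us. E (star x * (T u * E (star u * y))))"
      by (simp add: E_products)
    also have "\<dots> = E (star x * T y)"
      unfolding basic_construction_expand[OF T, of y, symmetric] sum_list_const_mult[symmetric] E_sum_list ..
    finally show "E (star (S x) * y) = E (star x * T y)" .
  qed
  also have "S = basic_sum E (map (\<lambda>u. (u, star (T u))) us)"
    by (simp add: S_def fun_eq_iff basic_sum_apply comp_def)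
  finally show ?thesis unfolding basic_construction_def by blast
qed

lemma rank_one_in: "rank_one a b \<in> basic_construction E"
  by (simp add: basic_construction_iff rank_one_def distrib_left E_add E_right flip: mult.assoc)

lemma left_mult_in: "left_mult c \<in> basic_construction E"
  by (simp add: basic_construction_iff left_mult_def distrib_left mult.assoc)

lemma comp_in: "S \<in> basic_construction E \<Longrightarrow> T \<in> basic_construction E \<Longrightarrow> S \<circ> T \<in> basic_construction E"
  by (simp add: basic_construction_iff)

text \<open>
  Writing \<open>\<Sum> T(u) u*\<close> shows that the value does not depend on the representation of \<open>T\<close> as a sum
  of elements \<open>a e b\<close>: each of them contributes \<open>a b\<close>.
\<close>

lemma dual_expectation_eq:
  assumes T: "T \<in> basic_construction E"
  shows "dual_expectation E T = mult_inverse (cstar_index E) * (\<Sum>u\<leftarrow>us. T u * star u)"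
  unfolding dual_expectation_def
proof (rule the_equality)
  let ?j = "mult_inverse (cstar_index E)"
  have "T = basic_sum E (map (\<lambda>u. (T u, star u)) us)"
    using basic_construction_expand[OF T] by (intro ext) (simp add: basic_sum_apply comp_def)
  moreover have "?j * (\<Sum>u\<leftarrow>us. T u * star u) = (\<Sum>(a, b)\<leftarrow>map (\<lambda>u. (T u, star u)) us. ?j * a * b)"
    by (simp add: sum_list_const_mult comp_def mult.assoc)
  ultimately show "\<exists>ps. T = basic_sum E ps \<and> ?j * (\<Sum>u\<leftarrow>us. T u * star u) = (\<Sum>(a, b)\<leftarrow>ps. ?j * a * b)"
    by blast
  fix c assume "\<exists>ps. T = basic_sum E ps \<and> c = (\<Sum>(a, b)\<leftarrow>ps. ?j * a * b)"
  then obtain ps where ps: "T = basic_sum E ps" "c = (\<Sum>(a, b)\<leftarrow>ps. ?j * a * b)" by blast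
  have "(\<Sum>u\<leftarrow>us. T u * star u) = (\<Sum>u\<leftarrow>us. \<Sum>p\<leftarrow>ps. fst p * (E (snd p * u) * star u))"
    unfolding ps basic_sum_apply sum_list_mult_const[symmetric]
    by (simp add: case_prod_unfold mult.assoc)
  also have "\<dots> = (\<Sum>p\<leftarrow>ps. \<Sum>u\<leftarrow>us. fst p * (E (snd p * u) * star u))"
    by (rule sum_list_swap)
  also have "\<dots> = (\<Sum>p\<leftarrow>ps. fst p * snd p)"
    by (simp only: sum_list_const_mult quasi_basis_right)
  finally show "c = ?j * (\<Sum>u\<leftarrow>us. T u * star u)"
    by (simp add: ps(2) sum_list_const_mult case_prod_unfold mult.assoc)
qed

text \<open>
  The elements \<open>u e v\<close>, with \<open>u\<close> and \<open>v\<close> in a quasi-basis of \<open>E\<close>, form a quasi-basis for the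
  dual expectation. The more familiar family \<open>u e k\<^bsup>1/2\<^esup>\<close>, where \<open>k\<close> is the index, would require
  a square root of \<open>k\<close>; here \<open>k = \<Sum> v v*\<close> takes its place.
\<close>

lemma dual_index_eq: "dual_index E = left_mult (cstar_index E)"
proof -
  let ?R = "basic_construction E" and ?EC = "left_mult \<circ> dual_expectation E"
  let ?j = "mult_inverse (cstar_index E)" and ?k = "cstar_index E"
  define ws where "ws = concat (map (\<lambda>u. map (rank_one u) us) us)"
  have kj: "(\<Sum>v\<leftarrow>us. v * (?j * star v)) = 1"
  proof -
    have "v * (?j * star v) = ?j * (v * star v)" for v
      by (simp only: index_inverse_central[of v] mult.assoc[symmetric])
    then have "(\<Sum>v\<leftarrow>us. v * (?j * star v)) = ?j * ?k"
      by (simp add: index_eq sum_list_const_mult)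
    then show ?thesis by (simp add: is_inverseD[OF index_is_inverse])
  qed
  have "quasi_basis ?R (\<circ>) (module_adjoint E) ?EC ws"
    unfolding quasi_basis_def
  proof (intro conjI ballI)
    show "set ws \<subseteq> ?R" by (auto simp: ws_def rank_one_in)
    fix T assume T: "T \<in> ?R"
    show "(\<Sum>w\<leftarrow>ws. w \<circ> ?EC (module_adjoint E w \<circ> T)) = T"
    proof
      fix x
      define G where "G = (\<lambda>u. \<Sum>l\<leftarrow>us. E (star u * T l) * star l)"
      have EC: "dual_expectation E (rank_one (star v) (star u) \<circ> T) = ?j * (star v * G u)" for u v
        using dual_expectation_eq[OF comp_in[OF rank_one_in T]]
        by (simp add: rank_one_def G_def sum_list_const_mult mult.assoc)
      have "(\<Sum>w\<leftarrow>ws. w \<circ> ?EC (module_adjoint E w \<circ> T)) x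
          = (\<Sum>u\<leftarrow>us. \<Sum>v\<leftarrow>us. u * E (v * (?j * (star v * G u) * x)))"
        by (simp add: ws_def sum_list_pairs sum_list_apply module_adjoint_rank_one EC)
           (simp add: rank_one_def left_mult_def)
      also have "\<dots> = (\<Sum>u\<leftarrow>us. u * E ((\<Sum>v\<leftarrow>us. v * (?j * star v)) * (G u * x)))"
        by (simp only: sum_list_const_mult sum_list_mult_const[symmetric] E_sum_list mult.assoc)
      also have "\<dots> = (\<Sum>u\<leftarrow>us. u * E (star u * T x))"
      proof -
        have "E (G u * x) = E (star u * T x)" for u
        proof -
          have "E (G u * x) = (\<Sum>l\<leftarrow>us. E (star u * T l) * E (star l * x))"
            by (simp add: G_def E_sum_list E_products mult.assoc flip: sum_list_mult_const)
          also have "\<dots> = (\<Sum>l\<leftarrow>us. E (star u * (T l * E (star l * x))))"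
            by (simp add: E_products)
          also have "\<dots> = E (star u * T x)"
            unfolding basic_construction_expand[OF T, of x, symmetric] sum_list_const_mult[symmetric] E_sum_list ..
          finally show ?thesis .
        qed
        then show ?thesis by (simp add: kj)
      qed
      also have "\<dots> = T x" by (rule quasi_basis_left)
      finally show "(\<Sum>w\<leftarrow>ws. w \<circ> ?EC (module_adjoint E w \<circ> T)) x = T x" .
    qed
    show "(\<Sum>w\<leftarrow>ws. ?EC (T \<circ> w) \<circ> module_adjoint E w) = T"
    proof
      fix x
      have EC: "dual_expectation E (T \<circ> rank_one u v) = ?j * (T u * v)" for u v
      proof -
        have "T (u * E (v * l)) = T u * E (v * l)" for l
          using T E_in by (simp add: basic_construction_iff)
        then show ?thesis
          using dual_expectation_eq[OF comp_in[OF T rank_one_in]]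
          by (simp add: rank_one_def sum_list_const_mult quasi_basis_right mult.assoc)
      qed
      have "(\<Sum>w\<leftarrow>ws. ?EC (T \<circ> w) \<circ> module_adjoint E w) x
          = (\<Sum>u\<leftarrow>us. \<Sum>v\<leftarrow>us. ?j * (T u * v) * (star v * E (star u * x)))"
        by (simp add: ws_def sum_list_pairs sum_list_apply module_adjoint_rank_one EC)
           (simp add: rank_one_def left_mult_def)
      also have "\<dots> = (\<Sum>u\<leftarrow>us. ?j * (T u * (\<Sum>v\<leftarrow>us. v * star v) * E (star u * x)))"
        by (simp only: sum_list_const_mult[symmetric] sum_list_mult_const[symmetric] mult.assoc)
      also have "\<dots> = (\<Sum>u\<leftarrow>us. T u * E (star u * x))"
      proof -
        have "?j * (T u * ?k * y) = T u * y" for u y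
          by (simp only: index_central[of "T u"] mult.assoc is_inverseD(4)[OF index_is_inverse])
        then show ?thesis by (simp only: index_eq)
      qed
      also have "\<dots> = T x" by (rule basic_construction_expand[OF T])
      finally show "(\<Sum>w\<leftarrow>ws. ?EC (T \<circ> w) \<circ> module_adjoint E w) x = T x" .
    qed
  qed
  then have "dual_index E = (\<Sum>w\<leftarrow>ws. w \<circ> module_adjoint E w)"
    unfolding dual_index_def
  proof (rule watatani_index_eqI)
    fix S T assume S: "S \<in> ?R" and "T \<in> ?R"
    then show "S \<circ> T \<in> ?R" "module_adjoint E S \<in> ?R" "?EC S \<in> ?R"
      by (simp_all add: comp_in module_adjoint_in left_mult_in)
    fix xs :: "('c \<Rightarrow> 'c) list" and f :: "('c \<Rightarrow> 'c) \<Rightarrow> 'c \<Rightarrow> 'c"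
    show "S \<circ> (\<Sum>y\<leftarrow>xs. f y) = (\<Sum>y\<leftarrow>xs. S \<circ> f y)"
      using S by (intro ext) (simp add: sum_list_apply additive_sum_list basic_construction_iff)
    show "(\<Sum>y\<leftarrow>xs. f y) \<circ> S = (\<Sum>y\<leftarrow>xs. f y \<circ> S)"
      by (intro ext) (simp add: sum_list_apply)
  qed (simp_all add: comp_assoc)
  also have "\<dots> = left_mult ?k"
  proof
    fix x
    have "(\<Sum>w\<leftarrow>ws. w \<circ> module_adjoint E w) x = (\<Sum>u\<leftarrow>us. \<Sum>v\<leftarrow>us. u * E (v * (star v * E (star u * x))))"
      by (simp add: ws_def sum_list_pairs sum_list_apply module_adjoint_rank_one)
         (simp add: rank_one_def)
    also have "\<dots> = (\<Sum>u\<leftarrow>us. u * E (?k * E (star u * x)))"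
      by (simp only: index_eq sum_list_const_mult sum_list_mult_const[symmetric] E_sum_list mult.assoc)
    also have "\<dots> = (\<Sum>u\<leftarrow>us. ?k * (u * E (star u * x)))"
    proof -
      have "u * E (?k * E (star u * x)) = ?k * (u * E (star u * x))" for u
        by (simp only: E_left[OF index_in] E_fixes[OF E_in] index_central[of u] mult.assoc[symmetric])
      then show ?thesis by simp
    qed
    also have "\<dots> = left_mult ?k x"
      by (simp only: sum_list_const_mult quasi_basis_left left_mult_def)
    finally show "(\<Sum>w\<leftarrow>ws. w \<circ> module_adjoint E w) x = left_mult ?k x" .
  qed
  finally show ?thesis .
qed

end

section \<open>Quotients of free abelian groups\<close>

text \<open>
  The additive extension of \<open>g\<close> from the generators to the free abelian group.
\<close>

definition frag_eval :: "('k \<Rightarrow> 'v::real_vector) \<Rightarrow> ('k \<Rightarrow>\<^sub>0 int) \<Rightarrow> 'v"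
  where "frag_eval g f = (\<Sum>k\<in>Poly_Mapping.keys f. of_int (Poly_Mapping.lookup f k) *\<^sub>R g k)"

lemma frag_eval_superset:
  assumes "finite K" "Poly_Mapping.keys f \<subseteq> K"
  shows "frag_eval g f = (\<Sum>k\<in>K. of_int (Poly_Mapping.lookup f k) *\<^sub>R g k)"
  unfolding frag_eval_def using assms
  by (intro sum.mono_neutral_left) (auto simp: in_keys_iff)

lemma frag_eval_add: "frag_eval g (f + f') = frag_eval g f + frag_eval g f'"
proof -
  let ?K = "Poly_Mapping.keys f \<union> Poly_Mapping.keys f'"
  have "finite ?K" "Poly_Mapping.keys (f + f') \<subseteq> ?K" by (simp_all add: keys_add)
  then show ?thesis
    by (simp add: frag_eval_superset[of ?K] lookup_add scaleR_add_left sum.distrib)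
qed

lemma frag_eval_of [simp]: "frag_eval g (frag_of k) = g k"
  by (simp add: frag_eval_def)

lemma frag_eval_sum_list: "frag_eval g (\<Sum>x\<leftarrow>xs. h x) = (\<Sum>x\<leftarrow>xs. frag_eval g (h x))"
  by (rule additive_sum_list) (rule frag_eval_add)

lemma frag_eval_0: "frag_eval g 0 = 0"
  by (simp add: frag_eval_def)

lemma frag_eval_diff: "frag_eval g (f - f') = frag_eval g f - frag_eval g f'"
  using frag_eval_add[of g "f - f'" f'] by simp

lemma frag_extend_sum_list: "frag_extend b (\<Sum>x\<leftarrow>xs. h x) = (\<Sum>x\<leftarrow>xs. frag_extend b (h x))"
  by (rule additive_sum_list) (rule frag_extend_add)

locale free_quotient =
  fixes S :: "('c \<times> 'y \<times> 'd) set" and rel :: "('c \<times> 'y \<times> 'd \<Rightarrow>\<^sub>0 int) set"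
  assumes rel_keys: "r \<in> rel \<Longrightarrow> Poly_Mapping.keys r \<subseteq> S"
begin

abbreviation F where "F \<equiv> free_Abelian_group S"
abbreviation N where "N \<equiv> generate F rel"

definition cong_rel (infix "\<asymp>" 50)
  where "f \<asymp> g \<longleftrightarrow> f - g \<in> N"

lemma N_subgroup: "subgroup N F"
  using rel_keys by (intro group.generate_is_subgroup group_free_Abelian_group) auto

lemma N_keys: "n \<in> N \<Longrightarrow> Poly_Mapping.keys n \<subseteq> S"
  using subgroup.mem_carrier[OF N_subgroup] by simp

lemma N_add: "m \<in> N \<Longrightarrow> n \<in> N \<Longrightarrow> m + n \<in> N"
  using subgroup.m_closed[OF N_subgroup] by simp

lemma N_zero: "0 \<in> N"
  using subgroup.one_closed[OF N_subgroup] by simp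

lemma N_minus: "n \<in> N \<Longrightarrow> - n \<in> N"
  using subgroup.m_inv_closed[OF N_subgroup] N_keys by simp

lemma N_induct [consumes 1, case_names zero rel minus add]:
  assumes "n \<in> N" "P 0" "\<And>r. r \<in> rel \<Longrightarrow> P r" "\<And>n. P n \<Longrightarrow> P (- n)" "\<And>m n. P m \<Longrightarrow> P n \<Longrightarrow> P (m + n)"
  shows "P n"
  using assms(1)
proof (induction n rule: generate.induct)
  case (inv h)
  then show ?case using assms(3,4) rel_keys by simp
qed (use assms in auto)

lemma cong_refl: "f \<asymp> f"
  by (simp add: cong_rel_def N_zero)

lemma cong_sym: "f \<asymp> g \<Longrightarrow> g \<asymp> f"
  using N_minus[of "f - g"] by (simp add: cong_rel_def)

lemma cong_trans [trans]: "f \<asymp> g \<Longrightarrow> g \<asymp> h \<Longrightarrow> f \<asymp> h"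
  using N_add[of "f - g" "g - h"] by (simp add: cong_rel_def)

lemma cong_add: "f \<asymp> g \<Longrightarrow> f' \<asymp> g' \<Longrightarrow> f + f' \<asymp> g + g'"
  using N_add[of "f - g" "f' - g'"] by (simp add: cong_rel_def algebra_simps)

lemma cong_sum_list: "(\<And>x. x \<in> set xs \<Longrightarrow> f x \<asymp> g x) \<Longrightarrow> (\<Sum>x\<leftarrow>xs. f x) \<asymp> (\<Sum>x\<leftarrow>xs. g x)"
  by (induction xs) (auto intro: cong_refl cong_add)

text \<open>
  The set \<open>P\<close> is needed because the middle entry of a tensor ranges over a submodule only.
\<close>

lemma cong_additive:
  assumes add: "\<And>p q. p \<in> P \<Longrightarrow> q \<in> P \<Longrightarrow> h (p + q) \<asymp> h p + h q"
    and P: "0 \<in> P" "\<And>p q. p \<in> P \<Longrightarrow> q \<in> P \<Longrightarrow> p + q \<in> P"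
    and xs: "\<And>x. x \<in> set xs \<Longrightarrow> f x \<in> P"
  shows "h (\<Sum>x\<leftarrow>xs. f x :: 'm::comm_monoid_add) \<asymp> (\<Sum>x\<leftarrow>xs. h (f x))"
proof -
  have "h 0 \<asymp> h 0 + h 0" using add[of 0 0] P by simp
  then have "h 0 \<asymp> 0" using N_minus[of "- h 0"] by (simp add: cong_rel_def)
  then have "(\<Sum>x\<leftarrow>xs. f x) \<in> P \<and> h (\<Sum>x\<leftarrow>xs. f x) \<asymp> (\<Sum>x\<leftarrow>xs. h (f x))"
    using xs
  proof (induction xs)
    case (Cons x xs)
    then have x: "f x \<in> P" "(\<Sum>x\<leftarrow>xs. f x) \<in> P" and IH: "h (\<Sum>x\<leftarrow>xs. f x) \<asymp> (\<Sum>x\<leftarrow>xs. h (f x))" by auto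
    have "h (f x + (\<Sum>x\<leftarrow>xs. f x)) \<asymp> h (f x) + h (\<Sum>x\<leftarrow>xs. f x)" by (rule add[OF x])
    also have "h (f x) + h (\<Sum>x\<leftarrow>xs. f x) \<asymp> h (f x) + (\<Sum>x\<leftarrow>xs. h (f x))"
      by (intro cong_add cong_refl IH)
    finally show ?case using x P(2) by simp
  qed (use P(1) in simp)
  then show ?thesis by blast
qed

lemma mem_coset_iff: "g \<in> N #>\<^bsub>F\<^esub> f \<longleftrightarrow> g \<asymp> f"
  unfolding r_coset_def cong_rel_def by (auto simp: algebra_simps) (metis add.commute diff_add_cancel)

lemma coset_eq_iff: "N #>\<^bsub>F\<^esub> f = N #>\<^bsub>F\<^esub> g \<longleftrightarrow> f \<asymp> g"
  unfolding set_eq_iff mem_coset_iff by (meson cong_refl cong_sym cong_trans)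

lemma cong_keys: "g \<asymp> f \<Longrightarrow> Poly_Mapping.keys f \<subseteq> S \<Longrightarrow> Poly_Mapping.keys g \<subseteq> S"
  using N_keys[of "g - f"] keys_add[of "g - f" f] by (auto simp: cong_rel_def)

lemma tensor_class_eq:
  assumes "Poly_Mapping.keys f \<subseteq> S"
  shows "tensor_class (F Mod N) f = N #>\<^bsub>F\<^esub> f"
  unfolding tensor_class_def carrier_FactGroup
proof (rule the_equality)
  show "N #>\<^bsub>F\<^esub> f \<in> (\<lambda>x. N #>\<^bsub>F\<^esub> x) ` carrier F \<and> f \<in> N #>\<^bsub>F\<^esub> f"
    using assms by (auto simp: mem_coset_iff cong_refl)
next
  fix \<xi> assume "\<xi> \<in> (\<lambda>x. N #>\<^bsub>F\<^esub> x) ` carrier F \<and> f \<in> \<xi>"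
  then obtain g where "\<xi> = N #>\<^bsub>F\<^esub> g" "f \<asymp> g" by (auto simp: mem_coset_iff)
  then show "\<xi> = N #>\<^bsub>F\<^esub> f" using coset_eq_iff cong_sym by blast
qed

lemma frag_extend_keys:
  assumes b: "\<And>k. k \<in> S \<Longrightarrow> Poly_Mapping.keys (b k) \<subseteq> S" and f: "Poly_Mapping.keys f \<subseteq> S"
  shows "Poly_Mapping.keys (frag_extend b f) \<subseteq> S"
  using keys_frag_extend[of b f] b f by blast

lemma frag_extend_N:
  assumes "\<And>r. r \<in> rel \<Longrightarrow> frag_extend b r \<in> N" "n \<in> N"
  shows "frag_extend b n \<in> N"
  using assms(2)
  by (induction rule: N_induct) (auto simp: frag_extend_minus frag_extend_add assms(1) N_zero N_minus N_add)

lemma frag_eval_N: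
  assumes "\<And>r. r \<in> rel \<Longrightarrow> frag_eval g r = 0" "n \<in> N"
  shows "frag_eval g n = 0"
  using assms(2)
proof (induction rule: N_induct)
  case (minus n)
  then show ?case using frag_eval_diff[of g 0 n] by (simp add: frag_eval_0)
qed (simp_all add: frag_eval_0 frag_eval_add assms(1))

lemma frag_eval_cong:
  assumes "\<And>r. r \<in> rel \<Longrightarrow> frag_eval g r = 0" "f \<asymp> f'"
  shows "frag_eval g f = frag_eval g f'"
  using frag_eval_N[OF assms(1), of "f - f'"] assms(2) by (simp add: cong_rel_def frag_eval_diff)

text \<open>
  An endomorphism of the free group that preserves the relations acts on cosets through any
  representative, so the union collapses to a single coset.
\<close>

lemma map_coset:
  assumes b: "\<And>k. k \<in> S \<Longrightarrow> Poly_Mapping.keys (b k) \<subseteq> S" "\<And>r. r \<in> rel \<Longrightarrow> frag_extend b r \<in> N"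
    and f: "Poly_Mapping.keys f \<subseteq> S"
  shows "(\<Union>g\<in>N #>\<^bsub>F\<^esub> f. tensor_class (F Mod N) (frag_extend b g)) = N #>\<^bsub>F\<^esub> frag_extend b f"
proof -
  have "tensor_class (F Mod N) (frag_extend b g) = N #>\<^bsub>F\<^esub> frag_extend b f" if g: "g \<in> N #>\<^bsub>F\<^esub> f" for g
  proof -
    have gf: "g \<asymp> f" using g by (simp add: mem_coset_iff)
    have "Poly_Mapping.keys (frag_extend b g) \<subseteq> S"
      by (intro frag_extend_keys b(1) cong_keys[OF gf f])
    moreover have "frag_extend b g \<asymp> frag_extend b f"
      using frag_extend_N[OF b(2), of "g - f"] gf by (simp add: cong_rel_def frag_extend_diff)
    ultimately show ?thesis by (simp add: tensor_class_eq coset_eq_iff)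
  qed
  moreover have "f \<in> N #>\<^bsub>F\<^esub> f" by (simp add: mem_coset_iff cong_refl)
  ultimately show ?thesis by blast
qed

end

section \<open>Hilbert modules and the bimodule expectation\<close>

context left_hilbert_module
begin

lemma lact_add_right: "lact c (x + y) = lact c x + lact c y"
  by (rule clinear_add[OF lact_linear])

lemma lact_add_left: "lact (c + c') y = lact c y + lact c' y"
  by (rule clinear_add[OF lact_linear_left])

lemma lact_sum_list_right: "lact c (\<Sum>x\<leftarrow>xs. f x) = (\<Sum>x\<leftarrow>xs. lact c (f x))"
  by (rule additive_sum_list) (rule lact_add_right)

lemma lact_sum_list_left: "lact (\<Sum>x\<leftarrow>xs. f x) y = (\<Sum>x\<leftarrow>xs. lact (f x) y)"
  by (rule additive_sum_list) (rule lact_add_left)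

lemma lact_zero_left: "lact 0 y = 0"
  using additive_zero[of "\<lambda>c. lact c y"] by (simp add: lact_add_left)

lemma norm_lact_le: "norm (lact c y) \<le> norm c * norm y"
proof -
  have "lip y (lact c y) = lip y y * star c"
    using lip_star[of "lact c y" y] lip_star[of y y] by (simp add: lip_lact star_mult)
  then have "(norm (lact c y))\<^sup>2 = norm (c * (lip y y * star c))"
    using norm_lip[of "lact c y"] by (simp add: lip_lact)
  also have "\<dots> \<le> norm c * ((norm y)\<^sup>2 * norm c)"
    by (intro norm_mult_le) (simp_all add: norm_lip)
  finally have "(norm (lact c y))\<^sup>2 \<le> (norm c * norm y)\<^sup>2"
    by (simp add: power2_eq_square mult_ac)
  then show ?thesis by (rule power2_le_imp_le) simp
qed

lemma lact_annihilator_closed: "closed {c. lact c y = 0}"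
proof -
  have "bounded_linear (\<lambda>c. lact c y)"
    by (rule bounded_linear_intro[of _ "norm y"])
       (simp_all add: lact_add_left clinear_scaleR[OF lact_linear_left] norm_lact_le)
  then have "continuous_on UNIV (\<lambda>c. lact c y)"
    by (simp add: linear_continuous_on)
  then show ?thesis by (intro closed_Collect_eq) auto
qed

lemma lact_annihilator_subspace: "complex_vector.subspace {c. lact c y = 0}"
  by (rule complex_vector.subspaceI)
     (simp_all add: lact_add_left clinear_scaleC[OF lact_linear_left] lact_zero_left)

end

context right_hilbert_module
begin

lemma ract_add_left: "ract (x + y) d = ract x d + ract y d"
  by (rule clinear_add[OF ract_linear])

lemma ract_add_right: "ract y (d + d') = ract y d + ract y d'"
  by (rule clinear_add[OF ract_linear_right])

lemma ract_sum_list_left: "ract (\<Sum>x\<leftarrow>xs. f x) d = (\<Sum>x\<leftarrow>xs. ract (f x) d)"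
  by (rule additive_sum_list) (rule ract_add_left)

lemma ract_sum_list_right: "ract y (\<Sum>x\<leftarrow>xs. f x) = (\<Sum>x\<leftarrow>xs. ract y (f x))"
  by (rule additive_sum_list) (rule ract_add_right)

lemma ract_zero_right: "ract y 0 = 0"
  using additive_zero[of "ract y"] by (simp add: ract_add_right)

lemma rip_add: "rip x (y + z) = rip x y + rip x z"
  by (rule clinear_add[OF rip_linear])

lemma rip_sum_list: "rip x (\<Sum>z\<leftarrow>zs. f z) = (\<Sum>z\<leftarrow>zs. rip x (f z))"
  by (rule additive_sum_list) (rule rip_add)

lemma rip_diff: "rip x (y - z) = rip x y - rip x z"
  using rip_add[of x "y - z" z] by simp

end

context strongly_morita_equivalent_inclusions
begin

text \<open>
  The identity \<open>\<langle>x', x\<rangle> z = x' \<langle>x, z\<rangle>\<close> shows that the inner products of \<open>X\<close> annihilate \<open>z\<close>;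
  since their span is dense in \<open>A\<close>, the unit annihilates \<open>z\<close> as well.
\<close>

lemma X_separates:
  assumes "\<And>x. x \<in> X \<Longrightarrow> rip x z = 0"
  shows "z = 0"
proof -
  have "{lip x y |x y. x \<in> X \<and> y \<in> X} \<subseteq> {c. lact c z = 0}"
    using assms by (auto simp: lip_rip ract_zero_right)
  then have "complex_vector.span {lip x y |x y. x \<in> X \<and> y \<in> X} \<subseteq> {c. lact c z = 0}"
    by (intro complex_vector.span_minimal lact_annihilator_subspace)
  then have "A \<subseteq> {c. lact c z = 0}"
    unfolding lip_X_full[symmetric] by (intro closure_minimal lact_annihilator_closed)
  moreover have "1 \<in> A" using inclusion_left by (simp add: unital_inclusion_def)
  ultimately show ?thesis using lact_one[of z] by auto
qed

lemma X_zero: "0 \<in> X" and X_add: "x \<in> X \<Longrightarrow> y \<in> X \<Longrightarrow> x + y \<in> X"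
  using X_subspace by (simp_all add: complex_vector.subspace_0 complex_vector.subspace_add)

end

locale bimodule_expectation =
  strongly_morita_equivalent_inclusions A B lact ract lip rip X +
  left: finite_index_expectation A E\<^sub>A us + right: finite_index_expectation B E\<^sub>B vs
  for A :: "'c::cstar_algebra set" and B :: "'d::cstar_algebra set"
    and lact :: "'c \<Rightarrow> 'y::complex_banach \<Rightarrow> 'y" and ract :: "'y \<Rightarrow> 'd \<Rightarrow> 'y"
    and lip :: "'y \<Rightarrow> 'y \<Rightarrow> 'c" and rip :: "'y \<Rightarrow> 'y \<Rightarrow> 'd"
    and X :: "'y set" and E\<^sub>A us E\<^sub>B vs +
  fixes E\<^sub>X :: "'y \<Rightarrow> 'y"
  assumes bimodule_expectation: "bimodule_conditional_expectation A B lact ract lip rip X E\<^sub>A E\<^sub>B E\<^sub>X"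
begin

lemma EX_add: "E\<^sub>X (x + y) = E\<^sub>X x + E\<^sub>X y"
  using bimodule_expectation unfolding bimodule_conditional_expectation_def by (intro clinear_add) simp

lemma EX_in: "E\<^sub>X y \<in> X"
  and EX_lact: "x \<in> X \<Longrightarrow> E\<^sub>X (lact c x) = lact (E\<^sub>A c) x" "a \<in> A \<Longrightarrow> E\<^sub>X (lact a y) = lact a (E\<^sub>X y)"
  and EX_ract: "x \<in> X \<Longrightarrow> E\<^sub>X (ract x d) = ract x (E\<^sub>B d)" "b \<in> B \<Longrightarrow> E\<^sub>X (ract y b) = ract (E\<^sub>X y) b"
  and EX_rip: "x \<in> X \<Longrightarrow> E\<^sub>B (rip y x) = rip (E\<^sub>X y) x"
  using bimodule_expectation unfolding bimodule_conditional_expectation_def by auto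

lemma EX_sum_list: "E\<^sub>X (\<Sum>x\<leftarrow>xs. f x) = (\<Sum>x\<leftarrow>xs. E\<^sub>X (f x))"
  by (rule additive_sum_list) (rule EX_add)

lemma EX_rip': "x \<in> X \<Longrightarrow> rip x (E\<^sub>X y) = E\<^sub>B (rip x y)"
  using EX_rip[of x y] by (metis rip_star right.E_star)

text \<open>
  A quasi-basis of \<open>E\<^sub>B\<close> is also one for \<open>E\<^sub>X\<close>: both sides have the same inner products with
  elements of \<open>X\<close>.
\<close>

lemma EX_quasi_basis: "(\<Sum>v\<leftarrow>vs. ract (E\<^sub>X (ract y v)) (star v)) = y"
proof -
  have "rip x ((\<Sum>v\<leftarrow>vs. ract (E\<^sub>X (ract y v)) (star v)) - y) = 0" if "x \<in> X" for x
    using that by (simp add: rip_diff rip_sum_list rip_ract EX_rip' right.quasi_basis_right)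
  from X_separates[OF this] show ?thesis by simp
qed

subsection \<open>The upward basic construction\<close>

abbreviation rels where "rels \<equiv> upward_relations A B lact ract X"

lemma rels_intros:
  "x \<in> X \<Longrightarrow> frag_of (c + c', x, d) - frag_of (c, x, d) - frag_of (c', x, d) \<in> rels"
  "x \<in> X \<Longrightarrow> x' \<in> X \<Longrightarrow> frag_of (c, x + x', d) - frag_of (c, x, d) - frag_of (c, x', d) \<in> rels"
  "x \<in> X \<Longrightarrow> frag_of (c, x, d + d') - frag_of (c, x, d) - frag_of (c, x, d') \<in> rels"
  "a \<in> A \<Longrightarrow> x \<in> X \<Longrightarrow> frag_of (c * a, x, d) - frag_of (c, lact a x, d) \<in> rels"
  "b \<in> B \<Longrightarrow> x \<in> X \<Longrightarrow> frag_of (c, ract x b, d) - frag_of (c, x, d * star b) \<in> rels"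
  unfolding upward_relations_def by blast+

lemma rels_cases:
  assumes "r \<in> rels"
  obtains (add1) c c' x d where "x \<in> X" "r = frag_of (c + c', x, d) - frag_of (c, x, d) - frag_of (c', x, d)"
  | (add2) c x x' d where "x \<in> X" "x' \<in> X" "r = frag_of (c, x + x', d) - frag_of (c, x, d) - frag_of (c, x', d)"
  | (add3) c x d d' where "x \<in> X" "r = frag_of (c, x, d + d') - frag_of (c, x, d) - frag_of (c, x, d')"
  | (left) c a x d where "a \<in> A" "x \<in> X" "r = frag_of (c * a, x, d) - frag_of (c, lact a x, d)"
  | (right) c x b d where "b \<in> B" "x \<in> X" "r = frag_of (c, ract x b, d) - frag_of (c, x, d * star b)"
  using assms unfolding upward_relations_def by blast

sublocale free_quotient "UNIV \<times> X \<times> UNIV" rels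
proof
  have diff: "Poly_Mapping.keys (f - g) \<subseteq> S" if "Poly_Mapping.keys f \<subseteq> S" "Poly_Mapping.keys g \<subseteq> S"
    for f g :: "'c \<times> 'y \<times> 'd \<Rightarrow>\<^sub>0 int" and S
    using keys_diff[of f g] that by blast
  fix r assume "r \<in> rels"
  then show "Poly_Mapping.keys r \<subseteq> UNIV \<times> X \<times> UNIV"
    by (cases rule: rels_cases) (simp_all add: diff keys_frag_of X_add lact_X ract_X)
qed

notation cong_rel (infix "\<asymp>" 50)

lemma upward_construction_eq: "upward_construction A B lact ract X = F Mod N"
  by (simp add: upward_construction_def Let_def)

abbreviation tensor where "tensor c x d \<equiv> frag_of (c, x, d)"

lemma cong_relI: "f - g \<in> rels \<Longrightarrow> f \<asymp> g"
  by (simp add: cong_rel_def generate.incl)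

lemma tensor_sum_left:
  assumes "x \<in> X"
  shows "tensor (\<Sum>u\<leftarrow>ws. f u) x d \<asymp> (\<Sum>u\<leftarrow>ws. tensor (f u) x d)"
  by (rule cong_additive[where P = UNIV and h = "\<lambda>c. tensor c x d"])
     (auto intro!: cong_relI simp: rels_intros assms simp flip: diff_diff_add)

lemma tensor_sum_middle:
  assumes "\<And>u. u \<in> set ws \<Longrightarrow> f u \<in> X"
  shows "tensor c (\<Sum>u\<leftarrow>ws. f u) d \<asymp> (\<Sum>u\<leftarrow>ws. tensor c (f u) d)"
  by (rule cong_additive[where P = X and h = "\<lambda>x. tensor c x d"])
     (auto intro!: cong_relI simp: rels_intros assms X_zero X_add simp flip: diff_diff_add)

lemma tensor_sum_right:
  assumes "x \<in> X"
  shows "tensor c x (\<Sum>u\<leftarrow>ws. f u) \<asymp> (\<Sum>u\<leftarrow>ws. tensor c x (f u))"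
  by (rule cong_additive[where P = UNIV and h = "\<lambda>d. tensor c x d"])
     (auto intro!: cong_relI simp: rels_intros assms simp flip: diff_diff_add)

lemma tensor_balance_left: "a \<in> A \<Longrightarrow> x \<in> X \<Longrightarrow> tensor (c * a) x d \<asymp> tensor c (lact a x) d"
  by (intro cong_relI rels_intros)

lemma tensor_balance_right: "b \<in> B \<Longrightarrow> x \<in> X \<Longrightarrow> tensor c (ract x b) d \<asymp> tensor c x (d * star b)"
  by (intro cong_relI rels_intros)

text \<open>
  The actions of the two Jones projections, lifted to formal sums.
\<close>

definition jones_left :: "('c \<times> 'y \<times> 'd \<Rightarrow>\<^sub>0 int) \<Rightarrow> ('c \<times> 'y \<times> 'd \<Rightarrow>\<^sub>0 int)"
  where "jones_left = frag_extend (\<lambda>(c, x, d). tensor (E\<^sub>A c) x d)"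

definition jones_right :: "('c \<times> 'y \<times> 'd \<Rightarrow>\<^sub>0 int) \<Rightarrow> ('c \<times> 'y \<times> 'd \<Rightarrow>\<^sub>0 int)"
  where "jones_right = frag_extend (\<lambda>(c, x, d). tensor c x (E\<^sub>B d))"

lemma jones_left_keys:
  "Poly_Mapping.keys f \<subseteq> UNIV \<times> X \<times> UNIV \<Longrightarrow> Poly_Mapping.keys (jones_left f) \<subseteq> UNIV \<times> X \<times> UNIV"
  unfolding jones_left_def by (rule frag_extend_keys) auto

lemma upward_lact_jones:
  assumes f: "Poly_Mapping.keys f \<subseteq> UNIV \<times> X \<times> UNIV"
  shows "upward_lact (F Mod N) (jones_projection E\<^sub>A) (N #>\<^bsub>F\<^esub> f) = N #>\<^bsub>F\<^esub> jones_left f"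
  unfolding upward_lact_def jones_left_def jones_projection_def
proof (rule map_coset[OF _ _ f])
  fix r assume "r \<in> rels"
  then show "frag_extend (\<lambda>(c, x, d). tensor (E\<^sub>A c) x d) r \<in> N"
    by (cases rule: rels_cases)
       (auto intro!: generate.incl rels_intros simp: frag_extend_diff left.E_add left.E_right)
qed auto

lemma upward_ract_jones:
  assumes f: "Poly_Mapping.keys f \<subseteq> UNIV \<times> X \<times> UNIV"
  shows "upward_ract E\<^sub>B (F Mod N) (N #>\<^bsub>F\<^esub> f) (jones_projection E\<^sub>B) = N #>\<^bsub>F\<^esub> jones_right f"
  unfolding upward_ract_def jones_right_def right.module_adjoint_jones_projection
  unfolding jones_projection_def
proof (rule map_coset[OF _ _ f])
  fix r assume "r \<in> rels"
  then show "frag_extend (\<lambda>(c, x, d). tensor c x (E\<^sub>B d)) r \<in> N"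
    by (cases rule: rels_cases)
       (auto intro!: generate.incl rels_intros simp: frag_extend_diff right.E_add right.E_right right.star_in)
qed auto

text \<open>
  The case \<open>T = id\<close> makes the dual expectation well defined. The case \<open>T = E\<^sub>A\<close> and \<open>k = 1\<close> gives
  the map on tensors that detects the elements of \<open>X\<close>.
\<close>

lemma frag_eval_rels:
  assumes add: "\<And>c c'. T (c + c') = T c + T c'" and module: "\<And>c a. a \<in> A \<Longrightarrow> T (c * a) = T c * a"
    and r: "r \<in> rels"
  shows "frag_eval (\<lambda>(c, x, d). lact k (ract (lact (T c) x) (star d))) r = 0"
  using r
proof (cases rule: rels_cases)
  case (right c x b d)
  then show ?thesis
    by (simp add: frag_eval_diff star_mult star_star ract_mult lact_ract)
qed (simp_all add: frag_eval_diff add module star_add lact_add_left lact_add_right ract_add_left ract_add_right lact_mult)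

lemma upward_expectation_coset:
  "upward_expectation lact ract E\<^sub>A (N #>\<^bsub>F\<^esub> f)
    = frag_eval (\<lambda>(c, x, d). lact (mult_inverse (cstar_index E\<^sub>A)) (ract (lact c x) (star d))) f"
    (is "_ = frag_eval ?g f")
proof -
  have eval: "(\<Sum>(c, x, d)\<in>Poly_Mapping.keys g. of_int (Poly_Mapping.lookup g (c, x, d)) *\<^sub>R
      lact (mult_inverse (cstar_index E\<^sub>A)) (ract (lact c x) (star d))) = frag_eval ?g g" for g
    unfolding frag_eval_def by (simp add: case_prod_unfold)
  have "frag_eval ?g r = 0" if "r \<in> rels" for r
    by (rule frag_eval_rels[of "\<lambda>c. c"]) (simp_all add: that)
  then have "frag_eval ?g g = frag_eval ?g f" if "g \<in> N #>\<^bsub>F\<^esub> f" for g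
    using that by (intro frag_eval_cong) (simp_all add: mem_coset_iff)
  moreover have "f \<in> N #>\<^bsub>F\<^esub> f" by (simp add: mem_coset_iff cong_refl)
  ultimately show ?thesis
    unfolding upward_expectation_def eval by (intro the_equality) blast+
qed

definition inclusion_sum :: "'y \<Rightarrow> ('c \<times> 'y \<times> 'd \<Rightarrow>\<^sub>0 int)"
  where "inclusion_sum y = (\<Sum>u\<leftarrow>us. \<Sum>v\<leftarrow>vs. tensor u (E\<^sub>X (ract (lact (star u) y) v)) v)"

lemma keys_sum_list:
  "(\<And>x. x \<in> set xs \<Longrightarrow> Poly_Mapping.keys (f x) \<subseteq> S) \<Longrightarrow> Poly_Mapping.keys (\<Sum>x\<leftarrow>xs. f x) \<subseteq> S"
proof (induction xs)
  case (Cons x xs)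
  then show ?case using keys_add[of "f x" "\<Sum>x\<leftarrow>xs. f x"] by fastforce
qed simp

lemma inclusion_sum_keys: "Poly_Mapping.keys (inclusion_sum y) \<subseteq> UNIV \<times> X \<times> UNIV"
  unfolding inclusion_sum_def by (intro keys_sum_list) (auto simp: EX_in)

lemma upward_inclusion_eq:
  "upward_inclusion lact ract E\<^sub>X us vs (F Mod N) y = N #>\<^bsub>F\<^esub> inclusion_sum y"
  unfolding upward_inclusion_def
  by (simp only: tensor_class_eq[OF inclusion_sum_keys] flip: inclusion_sum_def)

text \<open>
  This and the next identity remove one of the two sums in the inclusion map after a Jones
  projection has been applied.
\<close>

lemma EX_left_contract: "(\<Sum>u\<leftarrow>us. lact (E\<^sub>A u) (E\<^sub>X (ract (lact (star u) y) d))) = E\<^sub>X (ract y d)"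
proof -
  have "(\<Sum>u\<leftarrow>us. lact (E\<^sub>A u) (E\<^sub>X (ract (lact (star u) y) d)))
      = E\<^sub>X (\<Sum>u\<leftarrow>us. lact (E\<^sub>A u * star u) (ract y d))"
    by (simp add: EX_sum_list lact_ract lact_mult EX_lact left.E_in)
  also have "(\<Sum>u\<leftarrow>us. lact (E\<^sub>A u * star u) (ract y d)) = ract y d"
    by (simp only: lact_sum_list_left[symmetric] left.quasi_basis_one lact_one)
  finally show ?thesis .
qed

lemma EX_right_contract: "(\<Sum>v\<leftarrow>vs. ract (E\<^sub>X (ract y v)) (star (E\<^sub>B v))) = E\<^sub>X y"
proof -
  have "(\<Sum>v\<leftarrow>vs. ract (E\<^sub>X (ract y v)) (star (E\<^sub>B v))) = E\<^sub>X (\<Sum>v\<leftarrow>vs. ract y (v * star (E\<^sub>B v)))"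
    by (simp add: EX_sum_list ract_mult EX_ract right.E_in right.star_in)
  also have "(\<Sum>v\<leftarrow>vs. ract y (v * star (E\<^sub>B v))) = y"
    by (simp only: ract_sum_list_right[symmetric] right.quasi_basis_one ract_one)
  finally show ?thesis .
qed

lemma jones_left_inclusion_sum:
  "jones_left (inclusion_sum y) = (\<Sum>u\<leftarrow>us. \<Sum>v\<leftarrow>vs. tensor (E\<^sub>A u) (E\<^sub>X (ract (lact (star u) y) v)) v)"
  by (simp add: jones_left_def inclusion_sum_def frag_extend_sum_list)

lemma jones_right_inclusion_sum:
  "jones_right (inclusion_sum y) = (\<Sum>u\<leftarrow>us. \<Sum>v\<leftarrow>vs. tensor u (E\<^sub>X (ract (lact (star u) y) v)) (E\<^sub>B v))"
  by (simp add: jones_right_def inclusion_sum_def frag_extend_sum_list)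

lemma jones_left_cong:
  "jones_left (inclusion_sum y) \<asymp> (\<Sum>v\<leftarrow>vs. tensor 1 (E\<^sub>X (ract y v)) v)"
proof -
  have "jones_left (inclusion_sum y)
      \<asymp> (\<Sum>u\<leftarrow>us. \<Sum>v\<leftarrow>vs. tensor 1 (lact (E\<^sub>A u) (E\<^sub>X (ract (lact (star u) y) v))) v)"
    unfolding jones_left_inclusion_sum
    using tensor_balance_left[OF left.E_in EX_in, of 1] by (intro cong_sum_list) simp
  also have "\<dots> = (\<Sum>v\<leftarrow>vs. \<Sum>u\<leftarrow>us. tensor 1 (lact (E\<^sub>A u) (E\<^sub>X (ract (lact (star u) y) v))) v)"
    by (rule sum_list_swap)
  also have "\<dots> \<asymp> (\<Sum>v\<leftarrow>vs. tensor 1 (\<Sum>u\<leftarrow>us. lact (E\<^sub>A u) (E\<^sub>X (ract (lact (star u) y) v))) v)"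
    by (intro cong_sum_list cong_sym[OF tensor_sum_middle] lact_X left.E_in EX_in)
  finally show ?thesis by (simp only: EX_left_contract)
qed

lemma jones_right_cong:
  "jones_right (inclusion_sum y) \<asymp> (\<Sum>u\<leftarrow>us. tensor u (E\<^sub>X (lact (star u) y)) 1)"
proof -
  have "tensor u (E\<^sub>X (ract (lact (star u) y) v)) (E\<^sub>B v)
      \<asymp> tensor u (ract (E\<^sub>X (ract (lact (star u) y) v)) (star (E\<^sub>B v))) 1" for u v
    using cong_sym[OF tensor_balance_right[OF right.star_in[OF right.E_in[of v]] EX_in, of _ _ 1]]
    by (simp add: star_star)
  then have "jones_right (inclusion_sum y)
      \<asymp> (\<Sum>u\<leftarrow>us. \<Sum>v\<leftarrow>vs. tensor u (ract (E\<^sub>X (ract (lact (star u) y) v)) (star (E\<^sub>B v))) 1)"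
    unfolding jones_right_inclusion_sum by (intro cong_sum_list)
  also have "\<dots> \<asymp> (\<Sum>u\<leftarrow>us. tensor u (\<Sum>v\<leftarrow>vs. ract (E\<^sub>X (ract (lact (star u) y) v)) (star (E\<^sub>B v))) 1)"
    by (intro cong_sum_list cong_sym[OF tensor_sum_middle] ract_X right.star_in right.E_in EX_in)
  finally show ?thesis by (simp only: EX_right_contract)
qed

text \<open>
  For \<open>x\<close> in \<open>X\<close> both sides are the class of \<open>1 \<otimes> x \<otimes> 1\<close>.
\<close>

lemma X_commutes:
  assumes x: "x \<in> X"
  shows "jones_left (inclusion_sum x) \<asymp> jones_right (inclusion_sum x)"
proof -
  have "(\<Sum>v\<leftarrow>vs. tensor 1 (E\<^sub>X (ract x v)) v) \<asymp> (\<Sum>v\<leftarrow>vs. tensor 1 x (v * star (E\<^sub>B v)))"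
    using x by (auto intro!: cong_sum_list tensor_balance_right simp: EX_ract right.E_in)
  also have "\<dots> \<asymp> tensor 1 x 1"
    using cong_sym[OF tensor_sum_right[OF x, of 1 "\<lambda>v. v * star (E\<^sub>B v)" vs]]
    by (simp only: right.quasi_basis_one)
  finally have l: "jones_left (inclusion_sum x) \<asymp> tensor 1 x 1"
    using jones_left_cong cong_trans by blast
  have "(\<Sum>u\<leftarrow>us. tensor u (E\<^sub>X (lact (star u) x)) 1) \<asymp> (\<Sum>u\<leftarrow>us. tensor (u * E\<^sub>A (star u)) x 1)"
    using x by (auto intro!: cong_sum_list cong_sym[OF tensor_balance_left] simp: EX_lact left.E_in)
  also have "\<dots> \<asymp> tensor 1 x 1"
    using cong_sym[OF tensor_sum_left[OF x, of "\<lambda>u. u * E\<^sub>A (star u)" us 1]]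
    by (simp only: left.quasi_basis_one)
  finally have r: "jones_right (inclusion_sum x) \<asymp> tensor 1 x 1"
    using jones_right_cong cong_trans by blast
  show ?thesis using l r cong_sym cong_trans by blast
qed

text \<open>
  Apply \<open>c \<otimes> x \<otimes> d \<mapsto> E\<^sub>A(c) x d*\<close> to both sides. It recovers \<open>y\<close> from \<open>e\<^sub>A \<phi>(y)\<close> and \<open>E\<^sub>X(y)\<close>
  from \<open>\<phi>(y) e\<^sub>B\<close>, so \<open>y = E\<^sub>X(y)\<close>.
\<close>

lemma commutes_imp_X:
  assumes "jones_left (inclusion_sum y) \<asymp> jones_right (inclusion_sum y)"
  shows "y \<in> X"
proof -
  let ?g = "\<lambda>(c, x, d). lact 1 (ract (lact (E\<^sub>A c) x) (star d))"
  have idem: "E\<^sub>A (E\<^sub>A c) = E\<^sub>A c" for c by (simp add: left.E_fixes left.E_in)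
  have "frag_eval ?g (jones_left (inclusion_sum y))
      = (\<Sum>u\<leftarrow>us. \<Sum>v\<leftarrow>vs. ract (lact (E\<^sub>A u) (E\<^sub>X (ract (lact (star u) y) v))) (star v))"
    by (simp add: jones_left_inclusion_sum frag_eval_sum_list idem lact_one)
  also have "\<dots> = (\<Sum>v\<leftarrow>vs. \<Sum>u\<leftarrow>us. ract (lact (E\<^sub>A u) (E\<^sub>X (ract (lact (star u) y) v))) (star v))"
    by (rule sum_list_swap)
  also have "\<dots> = y"
    by (simp only: ract_sum_list_left[symmetric] EX_left_contract EX_quasi_basis)
  finally have l: "frag_eval ?g (jones_left (inclusion_sum y)) = y" .
  have "frag_eval ?g (jones_right (inclusion_sum y))
      = (\<Sum>u\<leftarrow>us. \<Sum>v\<leftarrow>vs. ract (lact (E\<^sub>A u) (E\<^sub>X (ract (lact (star u) y) v))) (star (E\<^sub>B v)))"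
    by (simp add: jones_right_inclusion_sum frag_eval_sum_list lact_one)
  also have "\<dots> = (\<Sum>v\<leftarrow>vs. \<Sum>u\<leftarrow>us. ract (lact (E\<^sub>A u) (E\<^sub>X (ract (lact (star u) y) v))) (star (E\<^sub>B v)))"
    by (rule sum_list_swap)
  also have "\<dots> = E\<^sub>X y"
    by (simp only: ract_sum_list_left[symmetric] EX_left_contract EX_right_contract)
  finally have r: "frag_eval ?g (jones_right (inclusion_sum y)) = E\<^sub>X y" .
  have "frag_eval ?g r = 0" if "r \<in> rels" for r
    by (rule frag_eval_rels) (simp_all add: that left.E_add left.E_right)
  then have "y = E\<^sub>X y"
    using frag_eval_cong[OF _ assms, of ?g] l r by simp
  then show ?thesis using EX_in[of y] by simp
qed

text \<open>
  The compression \<open>e\<^sub>A \<phi>(y) e\<^sub>B\<close> is the class of \<open>1 \<otimes> E\<^sub>X(y) \<otimes> 1\<close>, on which the dual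
  expectation is division by the index.
\<close>

lemma upward_expectation_compression:
  "upward_expectation lact ract E\<^sub>A (N #>\<^bsub>F\<^esub> jones_right (jones_left (inclusion_sum y)))
    = lact (mult_inverse (cstar_index E\<^sub>A)) (E\<^sub>X y)"
proof -
  let ?j = "mult_inverse (cstar_index E\<^sub>A)"
  have "jones_right (jones_left (inclusion_sum y))
      = (\<Sum>u\<leftarrow>us. \<Sum>v\<leftarrow>vs. tensor (E\<^sub>A u) (E\<^sub>X (ract (lact (star u) y) v)) (E\<^sub>B v))"
    by (simp add: jones_left_inclusion_sum jones_right_def frag_extend_sum_list)
  then have "upward_expectation lact ract E\<^sub>A (N #>\<^bsub>F\<^esub> jones_right (jones_left (inclusion_sum y)))
      = (\<Sum>u\<leftarrow>us. \<Sum>v\<leftarrow>vs. lact ?j (ract (lact (E\<^sub>A u) (E\<^sub>X (ract (lact (star u) y) v))) (star (E\<^sub>B v))))"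
    by (simp add: upward_expectation_coset frag_eval_sum_list)
  also have "\<dots> = (\<Sum>v\<leftarrow>vs. \<Sum>u\<leftarrow>us. lact ?j (ract (lact (E\<^sub>A u) (E\<^sub>X (ract (lact (star u) y) v))) (star (E\<^sub>B v))))"
    by (rule sum_list_swap)
  also have "\<dots> = lact ?j (E\<^sub>X y)"
    by (simp only: ract_sum_list_left[symmetric] lact_sum_list_right[symmetric] EX_left_contract EX_right_contract)
  finally show ?thesis .
qed

end

theorem proposition9p2:
  fixes A :: "'c::cstar_algebra set" and B :: "'d::cstar_algebra set"
    and lact :: "'c \<Rightarrow> 'y::complex_banach \<Rightarrow> 'y" and ract :: "'y \<Rightarrow> 'd \<Rightarrow> 'y"
    and lip :: "'y \<Rightarrow> 'y \<Rightarrow> 'c" and rip :: "'y \<Rightarrow> 'y \<Rightarrow> 'd"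
    and X :: "'y set"
    and E\<^sub>A :: "'c \<Rightarrow> 'c" and E\<^sub>B :: "'d \<Rightarrow> 'd" and E\<^sub>X :: "'y \<Rightarrow> 'y"
    and us :: "'c list" and vs :: "'d list"
  assumes "strongly_morita_equivalent_inclusions A B lact ract lip rip X"
    and "conditional_expectation A E\<^sub>A" and "conditional_expectation B E\<^sub>B"
    and "cstar_quasi_basis E\<^sub>A us" and "cstar_quasi_basis E\<^sub>B vs"
    and "cstar_index E\<^sub>A \<in> A" and "cstar_index E\<^sub>B \<in> B"
    and "bimodule_conditional_expectation A B lact ract lip rip X E\<^sub>A E\<^sub>B E\<^sub>X"
  shows "let Y\<^sub>1 = upward_construction A B lact ract X;
             \<phi> = upward_inclusion lact ract E\<^sub>X us vs Y\<^sub>1;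
             E\<^sub>Y = upward_expectation lact ract E\<^sub>A;
             e\<^sub>A = jones_projection E\<^sub>A;
             e\<^sub>B = jones_projection E\<^sub>B
         in X = {y. upward_lact Y\<^sub>1 e\<^sub>A (\<phi> y) = upward_ract E\<^sub>B Y\<^sub>1 (\<phi> y) e\<^sub>B} \<and>
            (\<exists>k. left_mult k = dual_index E\<^sub>A \<and>
                 (\<forall>y. E\<^sub>X y = lact k (E\<^sub>Y (upward_ract E\<^sub>B Y\<^sub>1 (upward_lact Y\<^sub>1 e\<^sub>A (\<phi> y)) e\<^sub>B))))"
proof -
  interpret morita: strongly_morita_equivalent_inclusions A B lact ract lip rip X by fact
  interpret bimodule_expectation A B lact ract lip rip X E\<^sub>A us E\<^sub>B vs E\<^sub>X
    by unfold_locales (use assms morita.inclusion_left morita.inclusion_right in auto)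
  have left_eq: "upward_lact (F Mod N) (jones_projection E\<^sub>A) (N #>\<^bsub>F\<^esub> inclusion_sum y)
      = N #>\<^bsub>F\<^esub> jones_left (inclusion_sum y)" for y
    by (rule upward_lact_jones[OF inclusion_sum_keys])
  have right_eq: "upward_ract E\<^sub>B (F Mod N) (N #>\<^bsub>F\<^esub> inclusion_sum y) (jones_projection E\<^sub>B)
      = N #>\<^bsub>F\<^esub> jones_right (inclusion_sum y)" for y
    by (rule upward_ract_jones[OF inclusion_sum_keys])
  have both_eq: "upward_ract E\<^sub>B (F Mod N) (N #>\<^bsub>F\<^esub> jones_left (inclusion_sum y)) (jones_projection E\<^sub>B)
      = N #>\<^bsub>F\<^esub> jones_right (jones_left (inclusion_sum y))" for y
    by (rule upward_ract_jones[OF jones_left_keys[OF inclusion_sum_keys]])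
  show ?thesis
    unfolding Let_def upward_construction_eq upward_inclusion_eq left_eq right_eq both_eq coset_eq_iff
      upward_expectation_compression
  proof (intro conjI exI allI)
    show "X = {y. cong_rel (jones_left (inclusion_sum y)) (jones_right (inclusion_sum y))}"
      using X_commutes commutes_imp_X by blast
    show "left_mult (cstar_index E\<^sub>A) = dual_index E\<^sub>A" by (rule left.dual_index_eq[symmetric])
    show "E\<^sub>X y = lact (cstar_index E\<^sub>A) (lact (mult_inverse (cstar_index E\<^sub>A)) (E\<^sub>X y))" for y
      by (simp add: morita.lact_one is_inverseD[OF left.index_is_inverse] flip: morita.lact_mult)
  qed
qed

end
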